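(* Let $B=C([0,1],\mathbb R^d)$ or $B=D([0,1],\mathbb R^d)$, with the sup norm $\|u\|_B=\sup_{0\le t\le 1}|u_t|$. Let $G:B\to B$ be a function such that the equation $G(x)=0$ has a unique solution $x^*\in B$, and suppose there are constants $0<\rho<1$ and $1\le\theta<\infty$ with $$\|\theta^{-1}G(x)-(x-x^* )\|_B\le\rho\|x-x^*\|_B\quad\text{for all }x\in B.$$ Let $\{\alpha_n:n\ge 0\}$ be a sequence of constants in $(0,1)$ with $\lim_n\alpha_n=0$, $\sum_{n=0}^\infty\alpha_n=\infty$ and $\sum_{n=0}^\infty\alpha_n^2<\infty$. Let $\{Z_n:n\ge 0\}$ be a sequence of independent $B$-valued martingales on a probability space $(\Omega,\mathcal F,\mathbb P)$, with mean $0$ and bounded variance; that is, writing $Z_n=(Z_{n,t})_{0\le t\le 1}$, for each $n$ we have $Z_{n,0}=0$, $$\mathbb E[Z_{n,t}\mid\sigma(Z_{n,u}:u\le s)]=Z_{n,s}\quad\text{for }0\le s<t\le 1,$$ and $$\mathbb E[|Z_{n,1}|^2]\le\sigma^2$$ for a constant $\sigma^2<\infty$ not depending on $n$. Fix $x_0\in B$ and define $X_0=x_0$ and $$X_{n+1}=X_n-\alpha_n\bigl(G(X_n)+Z_{n+1}\bigr),\quad n\ge 0.$$ Then $X_n$ converges to $x^*$ in $\|\cdot\|_B$ almost surely as $n\to\infty$.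
   Context: $C([0,1],\mathbb R^d)$ is the space of continuous functions and $D([0,1],\mathbb R^d)$ the space of right-continuous functions with left limits from $[0,1]$ to $\mathbb R^d$; $|\cdot|$ is the Euclidean norm on $\mathbb R^d$. A $B$-valued martingale is here an $\mathbb R^d$-valued stochastic process $(Z_{n,t})_{0\le t\le1}$, with all sample paths in $B$, that is a martingale in $t$ with respect to its own filtration. Independence of the sequence means independence of the $\sigma$-fields $\sigma(Z_{n,t}:0\le t\le 1)$, $n\ge0$. *)

theory Defs
  imports "HOL-Probability.Probability"
begin

text \<open>
  A function on \<open>[0,1]\<close> is represented by its extension by zero to \<open>real\<close>, so that equality of
  paths is equality in HOL and the spaces are closed under pointwise linear combinations.
\<close>

definition C01 :: "(real \<Rightarrow> real ^ 'd) set" where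
  "C01 = {f. continuous_on {0..1} f \<and> (\<forall>t. t \<notin> {0..1} \<longrightarrow> f t = 0)}"

definition D01 :: "(real \<Rightarrow> real ^ 'd) set" where
  "D01 = {f. (\<forall>t\<in>{0..<1}. (f \<longlongrightarrow> f t) (at_right t)) \<and>
             (\<forall>t\<in>{0<..1}. \<exists>l. (f \<longlongrightarrow> l) (at_left t)) \<and>
             (\<forall>t. t \<notin> {0..1} \<longrightarrow> f t = 0)}"

text \<open>Elements of \<open>C01\<close> and \<open>D01\<close> are bounded, so the supremum below is a genuine one.\<close>

definition sup_norm :: "(real \<Rightarrow> real ^ 'd) \<Rightarrow> real" where
  "sup_norm u = (SUP t\<in>{0..1}. norm (u t))"

definition process_sigma ::
  "'w measure \<Rightarrow> ('w \<Rightarrow> real \<Rightarrow> real ^ 'd) \<Rightarrow> real set \<Rightarrow> 'w measure" where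
  "process_sigma M Y I =
     sigma (space M) (\<Union>u\<in>I. {(\<lambda>\<omega>. Y \<omega> u) -` A \<inter> space M | A. A \<in> sets borel})"

definition vec_cond_exp ::
  "'w measure \<Rightarrow> 'w measure \<Rightarrow> ('w \<Rightarrow> real ^ 'd) \<Rightarrow> 'w \<Rightarrow> real ^ 'd" where
  "vec_cond_exp M F f = (\<lambda>\<omega>. \<chi> i. real_cond_exp M F (\<lambda>\<omega>'. f \<omega>' $ i) \<omega>)"

text \<open>Adaptedness is automatic, as the filtration is the one generated by the process itself.\<close>

definition martingale01 :: "'w measure \<Rightarrow> ('w \<Rightarrow> real \<Rightarrow> real ^ 'd) \<Rightarrow> bool" where
  "martingale01 M Y \<longleftrightarrow>
     (\<forall>t\<in>{0..1}. integrable M (\<lambda>\<omega>. Y \<omega> t)) \<and>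
     (\<forall>s t. 0 \<le> s \<and> s < t \<and> t \<le> 1 \<longrightarrow>
        (AE \<omega> in M. vec_cond_exp M (process_sigma M Y {0..s}) (\<lambda>\<omega>'. Y \<omega>' t) \<omega> = Y \<omega> s))"

definition valued_martingale ::
  "'w measure \<Rightarrow> (real \<Rightarrow> real ^ 'd) set \<Rightarrow> ('w \<Rightarrow> real \<Rightarrow> real ^ 'd) \<Rightarrow> bool" where
  "valued_martingale M B Y \<longleftrightarrow> (\<forall>\<omega>\<in>space M. Y \<omega> \<in> B) \<and> martingale01 M Y"

end

theory Submission
  imports Defs
begin

text \<open>
  The weighted noise \<open>\<Sum>k<n. \<alpha> k * Z (k + 1)\<close> converges uniformly in \<open>t\<close> almost surely. For fixed \<open>n\<close> it
  is a martingale in \<open>t\<close>, so Kolmogorov's first passage argument bounds the tail of its supremum over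
  \<open>t\<close> by its variance at \<open>t = 1\<close>, which is at most \<open>\<sigma>\<^sup>2 * (\<Sum>k<n. (\<alpha> k)\<^sup>2)\<close> by orthogonality.
  Independence in \<open>n\<close> and Ottaviani's inequality extend this to the maximum over \<open>n\<close>. Once the noise is
  uniformly Cauchy, the convergence of \<open>X n\<close> is deterministic: up to the partial noise sums, the error
  satisfies \<open>y (n + 1) \<le> (1 - (1 - \<rho>) * \<gamma> n) * y n + \<gamma> n * o(1)\<close> with \<open>\<gamma> n = \<theta> * \<alpha> n\<close>.
\<close>

subsection \<open>Path spaces and the noisy fixed point iteration\<close>

text \<open>Each \<open>Z k\<close> is a martingale only for its own filtration, so the weighted sum
  comes with no filtration to work in. It is never given one. For each \<open>k\<close> the
  increment of \<open>Z k\<close> after time \<open>t\<close> is tested against the past of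
  \<open>Z k\<close> up to \<open>t\<close> joined with the whole paths of other \<open>Z l\<close>
  (the sigma-field \<open>info\<close>); independence makes it orthogonal to that sigma-field. A
  first passage event of the sum lies in all these sigma-fields at once, one for each
  \<open>k\<close>, which is exactly what the first passage argument consumes. For the maximum over
  the number of terms, the quantity to control is already a maximum over times, to which
  orthogonality does not apply directly. Ottaviani's inequality asks only that early and late blocks
  be independent and that a late block be small with probability at least one half. Times are first
  finite in number, so that a first passage exists, then countable; right-continuity reaches the
  rest of the interval. Since \<open>C01\<close> lies inside \<open>D01\<close>, path arguments run
  in \<open>D01\<close>, and \<open>B\<close> itself serves to keep the iterates in the domain of
  \<open>G\<close>.\<close>

lemma C01_subset_D01: "C01 \<subseteq> D01"
proof
  fix f :: "real \<Rightarrow> real ^ 'd"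
  assume f: "f \<in> C01"
  then have c: "continuous_on {0..1} f" and z: "\<And>t. t \<notin> {0..1} \<Longrightarrow> f t = 0"
    by (auto simp: C01_def)
  have "(f \<longlongrightarrow> f t) (at_right t)" if "t \<in> {0..<1}" for t
  proof -
    have "(f \<longlongrightarrow> f t) (at t within {t..1})"
      by (rule tendsto_within_subset[where S = "{0..1}"]) (use c that in \<open>auto simp: continuous_on_def\<close>)
    then show ?thesis
      using that by (simp add: at_within_Icc_at_right)
  qed
  moreover have "\<exists>l. (f \<longlongrightarrow> l) (at_left t)" if "t \<in> {0<..1}" for t
  proof -
    have "(f \<longlongrightarrow> f t) (at t within {0..t})"
      by (rule tendsto_within_subset[where S = "{0..1}"]) (use c that in \<open>auto simp: continuous_on_def\<close>)
    then show ?thesis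
      using that by (auto simp: at_within_Icc_at_left)
  qed
  ultimately show "f \<in> D01"
    using z by (auto simp: D01_def)
qed

text \<open>Stated for both path spaces because the iterates have to stay in \<open>B\<close>
  itself: the contraction bound for \<open>G\<close> is available only there.\<close>

lemma path_space_lincomb:
  assumes "B = C01 \<or> B = D01" and "f \<in> B" "g \<in> B"
  shows "(\<lambda>t. a *\<^sub>R f t + b *\<^sub>R g t) \<in> B"
proof -
  have "(\<lambda>t. a *\<^sub>R f t + b *\<^sub>R g t) \<in> C01" if "f \<in> C01" "g \<in> C01"
    using that by (auto simp: C01_def intro!: continuous_intros)
  moreover have "(\<lambda>t. a *\<^sub>R f t + b *\<^sub>R g t) \<in> D01" if "f \<in> D01" "g \<in> D01"
    using that unfolding D01_def by (fastforce intro!: tendsto_intros)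
  ultimately show ?thesis
    using assms by auto
qed

lemma D01_lincomb:
  assumes "f \<in> D01" "g \<in> D01"
  shows "(\<lambda>t. a *\<^sub>R f t + b *\<^sub>R g t) \<in> D01"
  using path_space_lincomb[of D01] assms by blast

lemma D01_diff:
  assumes "f \<in> D01" "g \<in> D01"
  shows "(\<lambda>t. f t - g t) \<in> D01"
  using D01_lincomb[OF assms, of 1 "-1"] by simp

lemma D01_weighted_sum:
  assumes "finite K" "\<And>k. k \<in> K \<Longrightarrow> z k \<in> D01"
  shows "(\<lambda>t. \<Sum>k\<in>K. c k *\<^sub>R z k t) \<in> D01"
  using assms
proof (induction K)
  case empty
  show ?case by (simp add: D01_def exI[of _ 0])
next
  case (insert k K)
  then show ?case
    using D01_lincomb[of "z k" "\<lambda>t. \<Sum>k\<in>K. c k *\<^sub>R z k t" "c k" 1] by simp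
qed

text \<open>A real supremum says nothing about an unbounded set, so every use of
  \<open>sup_norm\<close> rests on this. One-sided limits bound \<open>f\<close> near each point,
  and bisection turns local boundedness into a global bound.\<close>

lemma D01_bounded:
  assumes f: "f \<in> D01"
  obtains C where "\<And>t. t \<in> {0..1} \<Longrightarrow> norm (f t) \<le> C"
proof -
  \<comment> \<open>The intersection with the unit interval is there because the short intervals
    around a point that \<open>Bolzano\<close> asks about may stick out of it.\<close>
  define P where "P = (\<lambda>(a, b). \<exists>C. \<forall>t\<in>{a..b} \<inter> {0..1}. norm (f t) \<le> C)"
  have loc: "\<exists>e>0. \<exists>C. \<forall>t. dist t x < e \<and> t \<in> {0..1} \<longrightarrow> norm (f t) \<le> C"
    if x: "0 \<le> x" "x \<le> 1" for x
  proof -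
    have r: "\<exists>b>x. \<exists>C. \<forall>t. x < t \<and> t < b \<and> t \<le> 1 \<longrightarrow> norm (f t) \<le> C"
    proof (cases "x < 1")
      case True
      with f x have "(f \<longlongrightarrow> f x) (at_right x)" by (auto simp: D01_def)
      then have "\<forall>\<^sub>F t in at_right x. dist (f t) (f x) < 1"
        by (rule tendstoD) simp
      then obtain b where b: "b > x" "\<And>t. x < t \<Longrightarrow> t < b \<Longrightarrow> dist (f t) (f x) < 1"
        by (auto simp: eventually_at_right_field)
      have "norm (f t) \<le> norm (f x) + 1" if "x < t" "t < b" for t
        using b(2)[OF that] norm_triangle_ineq2[of "f t" "f x"] by (simp add: dist_norm)
      then show ?thesis using b(1) by blast
    next
      case False
      then show ?thesis by (intro exI[of _ "x + 1"]) auto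
    qed
    have l: "\<exists>b<x. \<exists>C. \<forall>t. b < t \<and> t < x \<and> 0 \<le> t \<longrightarrow> norm (f t) \<le> C"
    proof (cases "x > 0")
      case True
      then have "x \<in> {0<..1}" using x by simp
      moreover have "\<forall>t\<in>{0<..1}. \<exists>l. (f \<longlongrightarrow> l) (at_left t)"
        using f by (simp add: D01_def)
      ultimately obtain l where "(f \<longlongrightarrow> l) (at_left x)" by blast
      then have "\<forall>\<^sub>F t in at_left x. dist (f t) l < 1"
        by (rule tendstoD) simp
      then obtain b where b: "b < x" "\<And>t. b < t \<Longrightarrow> t < x \<Longrightarrow> dist (f t) l < 1"
        by (auto simp: eventually_at_left_field)
      have "norm (f t) \<le> norm l + 1" if "b < t" "t < x" for t
        using b(2)[OF that] norm_triangle_ineq2[of "f t" l] by (simp add: dist_norm)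
      then show ?thesis using b(1) by blast
    next
      case False
      then show ?thesis by (intro exI[of _ "x - 1"]) auto
    qed
    from r obtain b C where b: "b > x" "\<And>t. x < t \<Longrightarrow> t < b \<Longrightarrow> t \<le> 1 \<Longrightarrow> norm (f t) \<le> C" by blast
    from l obtain a D where a: "a < x" "\<And>t. a < t \<Longrightarrow> t < x \<Longrightarrow> 0 \<le> t \<Longrightarrow> norm (f t) \<le> D" by blast
    have "norm (f t) \<le> max (norm (f x)) (max C D)"
      if "dist t x < min (b - x) (x - a)" "t \<in> {0..1}" for t
      using b(2)[of t] a(2)[of t] that
      by (cases t x rule: linorder_cases) (auto simp: dist_real_def max_def)
    moreover have "min (b - x) (x - a) > 0" using a b by simp
    ultimately show ?thesis by blast
  qed
  have "P (0, 1)"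
  proof (rule Bolzano)
    fix a b c :: real
    assume "P (a, b)" "P (b, c)" "a \<le> b" "b \<le> c"
    then obtain C D where CD: "\<forall>t\<in>{a..b} \<inter> {0..1}. norm (f t) \<le> C" "\<forall>t\<in>{b..c} \<inter> {0..1}. norm (f t) \<le> D"
      by (auto simp: P_def)
    have "norm (f t) \<le> max C D" if t: "t \<in> {a..c} \<inter> {0..1}" for t
    proof (cases "t \<le> b")
      case True
      then have "norm (f t) \<le> C" using CD(1) t by auto
      then show ?thesis by simp
    next
      case False
      then have "norm (f t) \<le> D" using CD(2) t by auto
      then show ?thesis by simp
    qed
    then show "P (a, c)"
      unfolding P_def by blast
  next
    fix x :: real
    assume "0 \<le> x" "x \<le> 1"
    from loc[OF this] obtain e C where e: "e > 0"
      "\<And>t. dist t x < e \<Longrightarrow> t \<in> {0..1} \<Longrightarrow> norm (f t) \<le> C" by blast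
    show "\<exists>d>0. \<forall>a b. a \<le> x \<and> x \<le> b \<and> b - a < d \<longrightarrow> P (a, b)"
    proof (intro exI[of _ e] conjI allI impI)
      fix a b
      assume *: "a \<le> x \<and> x \<le> b \<and> b - a < e"
      have "norm (f t) \<le> C" if "t \<in> {a..b} \<inter> {0..1}" for t
        using e(2)[of t] that * by (auto simp: dist_real_def)
      then show "P (a, b)" unfolding P_def by blast
    qed (use e in auto)
  qed simp
  then obtain C where "\<forall>t\<in>{0..1}. norm (f t) \<le> C"
    by (auto simp: P_def)
  then show ?thesis using that by blast
qed

lemma norm_le_sup_norm:
  assumes "u \<in> D01" "t \<in> {0..1}"
  shows "norm (u t) \<le> sup_norm u"
proof -
  obtain C where "\<And>t. t \<in> {0..1} \<Longrightarrow> norm (u t) \<le> C"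
    by (rule D01_bounded[OF assms(1)]) blast
  then have "bdd_above ((\<lambda>t. norm (u t)) ` {0..1})"
    by (intro bdd_aboveI2)
  then show ?thesis
    unfolding sup_norm_def using assms(2) by (rule cSUP_upper[rotated])
qed

lemma sup_norm_le:
  assumes "\<And>t. t \<in> {0..1} \<Longrightarrow> norm (u t) \<le> c"
  shows "sup_norm u \<le> c"
  unfolding sup_norm_def by (rule cSUP_least) (use assms in auto)

lemma sup_norm_nonneg:
  assumes "u \<in> D01"
  shows "0 \<le> sup_norm u"
  by (rule order_trans[OF norm_ge_zero norm_le_sup_norm[OF assms, of 0]]) simp

text \<open>Each step moves \<open>y\<close> towards \<open>a\<close> by the fraction
  \<open>g n\<close>, so an excess over \<open>a\<close> shrinks by \<open>1 - g n\<close>, which is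
  at most \<open>exp (- g n)\<close>. The divergent sum of the weights then sends the excess to
  zero.\<close>

lemma averaging_recursion_eventually_le:
  fixes y g :: "nat \<Rightarrow> real"
  assumes rec: "\<And>n. m \<le> n \<Longrightarrow> y (Suc n) \<le> (1 - g n) * y n + g n * a"
    and g: "\<And>n. m \<le> n \<Longrightarrow> 0 \<le> g n" "\<And>n. m \<le> n \<Longrightarrow> g n \<le> 1"
    and div: "filterlim (\<lambda>n. \<Sum>k<n. g k) at_top sequentially"
    and a: "a < b"
  shows "\<forall>\<^sub>F n in sequentially. y n \<le> b"
proof -
  \<comment> \<open>The positive part: \<open>y m\<close> may start below \<open>a\<close>, and
    replacing \<open>1 - g n\<close> by the exponential needs a nonnegative factor.\<close>
  define C where "C = max (y m - a) 0"
  have bound: "y n - a \<le> C * exp (- (\<Sum>k\<in>{m..<n}. g k))" if "m \<le> n" for n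
    using that
  proof (induction n rule: dec_induct)
    case base
    show ?case by (simp add: C_def)
  next
    case (step n)
    have "y (Suc n) - a \<le> (1 - g n) * (y n - a)"
      using rec[of n] step by (simp add: algebra_simps)
    also have "\<dots> \<le> (1 - g n) * (C * exp (- (\<Sum>k\<in>{m..<n}. g k)))"
      using step g by (intro mult_left_mono) auto
    also have "\<dots> \<le> exp (- g n) * (C * exp (- (\<Sum>k\<in>{m..<n}. g k)))"
      using exp_ge_add_one_self[of "- g n"] by (intro mult_right_mono) (auto simp: C_def)
    also have "\<dots> = C * exp (- (\<Sum>k\<in>{m..<Suc n}. g k))"
      using step by (simp add: exp_add[symmetric])
    finally show ?case .
  qed
  have "filterlim (\<lambda>n. - (\<Sum>k<m. g k) + (\<Sum>k<n. g k)) at_top sequentially"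
    using div by (intro filterlim_tendsto_add_at_top[OF tendsto_const])
  moreover have "\<forall>\<^sub>F n in sequentially. - (\<Sum>k<m. g k) + (\<Sum>k<n. g k) = (\<Sum>k\<in>{m..<n}. g k)"
    using eventually_ge_at_top[of m]
  proof eventually_elim
    case (elim n)
    then show ?case
      using sum.atLeastLessThan_concat[of 0 m n g] by (simp add: lessThan_atLeast0)
  qed
  ultimately have "filterlim (\<lambda>n. \<Sum>k\<in>{m..<n}. g k) at_top sequentially"
    by (simp cong: filterlim_cong)
  then have "(\<lambda>n. C * exp (- (\<Sum>k\<in>{m..<n}. g k))) \<longlonglongrightarrow> C * 0"
    by (intro tendsto_mult tendsto_const filterlim_compose[OF exp_at_bot])
       (simp add: filterlim_uminus_at_top)
  then have "\<forall>\<^sub>F n in sequentially. C * exp (- (\<Sum>k\<in>{m..<n}. g k)) < b - a"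
    using a by (intro order_tendstoD) auto
  then show ?thesis
    using eventually_ge_at_top[of m]
  proof eventually_elim
    case (elim n)
    then show ?case using bound[of n] by linarith
  qed
qed

text \<open>This turns a bound at countably many times, which can hold off a single null set, into a
  bound at all times. Rationals to the right of \<open>t\<close> suffice by right-continuity, and
  the end point 1, which has no right neighbourhood in the interval, is itself rational.\<close>

lemma D01_norm_le_if_rational:
  assumes f: "f \<in> D01" and le: "\<And>s. s \<in> {0..1} \<inter> \<rat> \<Longrightarrow> norm (f s) \<le> c"
    and t: "t \<in> {0..1}"
  shows "norm (f t) \<le> c"
proof (cases "t = 1")
  case True
  then show ?thesis using le[of 1] by simp
next
  case False
  with f t have "(f \<longlongrightarrow> f t) (at_right t)" by (auto simp: D01_def)
  then have lim: "((\<lambda>s. norm (f s)) \<longlongrightarrow> norm (f t)) (at_right t)"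
    by (rule tendsto_norm)
  show ?thesis
  proof (rule ccontr)
    assume "\<not> ?thesis"
    then have "\<forall>\<^sub>F s in at_right t. c < norm (f s)"
      by (intro order_tendstoD(1)[OF lim]) simp
    then obtain b where b: "b > t" "\<And>s. t < s \<Longrightarrow> s < b \<Longrightarrow> c < norm (f s)"
      by (auto simp: eventually_at_right_field)
    obtain q where q: "q \<in> \<rat>" "t < q" "q < min b 1"
      using Rats_dense_in_real[of t "min b 1"] b(1) t False by auto
    then show False using b(2)[of q] le[of q] t by auto
  qed
qed

text \<open>
  Adding the partial noise sums from time \<open>m\<close> on to the error \<open>x n - xstar\<close> removes the noise from
  the recursion, at the price of an error of order \<open>\<gamma> n * e\<close> in step \<open>n\<close>, where
  \<open>\<gamma> n = \<theta> * \<alpha> n\<close>.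
\<close>

lemma perturbed_contraction_converges:
  fixes x z :: "nat \<Rightarrow> real \<Rightarrow> real ^ 'd"
  assumes B: "B = C01 \<or> B = D01"
    and G: "G \<in> B \<rightarrow> B" and xstar: "xstar \<in> B" and x0: "x 0 \<in> B" and z: "\<And>n. z n \<in> B"
    and rho: "0 < \<rho>" "\<rho> < 1" and theta: "0 < \<theta>"
    and contraction: "\<And>x. x \<in> B \<Longrightarrow>
          sup_norm (\<lambda>t. inverse \<theta> *\<^sub>R G x t - (x t - xstar t)) \<le> \<rho> * sup_norm (\<lambda>t. x t - xstar t)"
    and alpha_pos: "\<And>n. 0 \<le> \<alpha> n" and alpha_lim: "\<alpha> \<longlonglongrightarrow> 0"
    and alpha_sum: "filterlim (\<lambda>n. \<Sum>k<n. \<alpha> k) at_top sequentially"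
    and rec: "\<And>n. x (Suc n) = (\<lambda>t. x n t - \<alpha> n *\<^sub>R (G (x n) t + z n t))"
    and noise: "\<And>e. 0 < e \<Longrightarrow> \<exists>m0. \<forall>m\<ge>m0. \<forall>n\<ge>m. \<forall>t\<in>{0..1}.
          norm (\<Sum>k\<in>{m..<n}. \<alpha> k *\<^sub>R z k t) \<le> e"
  shows "(\<lambda>n. sup_norm (\<lambda>t. x n t - xstar t)) \<longlonglongrightarrow> 0"
proof -
  have B_sub: "B \<subseteq> D01" using B C01_subset_D01 by auto
  have x: "x n \<in> B" for n
  proof (induction n)
    case (Suc n)
    have "(\<lambda>t. 1 *\<^sub>R x n t + (- \<alpha> n) *\<^sub>R (1 *\<^sub>R G (x n) t + 1 *\<^sub>R z n t)) \<in> B"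
      using Suc G z by (intro path_space_lincomb[OF B]) auto
    then show ?case by (simp add: rec)
  qed (rule x0)
  have xD: "x n \<in> D01" and GD: "G (x n) \<in> D01" and zD: "z n \<in> D01" and sD: "xstar \<in> D01" for n
    using x[of n] z[of n] xstar G B_sub by auto
  define \<gamma> where "\<gamma> = (\<lambda>n. \<theta> * \<alpha> n)"
  have g_pos: "0 \<le> \<gamma> n" for n using alpha_pos theta by (simp add: \<gamma>_def)
  have "\<gamma> \<longlonglongrightarrow> \<theta> * 0" unfolding \<gamma>_def by (intro tendsto_intros alpha_lim)
  then have "\<forall>\<^sub>F n in sequentially. \<gamma> n < 1" by (intro order_tendstoD) auto
  then obtain m1 where m1: "\<And>n. m1 \<le> n \<Longrightarrow> \<gamma> n < 1" by (auto simp: eventually_sequentially)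
  define \<delta> where "\<delta> = (\<lambda>n. sup_norm (\<lambda>t. x n t - xstar t))"
  have d_nonneg: "0 \<le> \<delta> n" for n
    unfolding \<delta>_def by (intro sup_norm_nonneg D01_diff xD sD)
  \<comment> \<open>The constant has three sources: \<open>(1 + \<rho>) / (1 - \<rho>)\<close> is
    the level of the averaging recursion, one \<open>e\<close> is the slack above that level, and
    one \<open>e\<close> pays for passing from \<open>y\<close> back to
    \<open>\<delta>\<close>.\<close>
  have main: "\<forall>\<^sub>F n in sequentially. \<delta> n \<le> (2 + (1 + \<rho>) / (1 - \<rho>)) * e" if e: "0 < e" for e
  proof -
    obtain m0 where m0: "\<And>m n t. m0 \<le> m \<Longrightarrow> m \<le> n \<Longrightarrow> t \<in> {0..1} \<Longrightarrow>
        norm (\<Sum>k\<in>{m..<n}. \<alpha> k *\<^sub>R z k t) \<le> e"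
      using noise[OF e] by blast
    define m where "m = max m0 m1"
    define T where "T = (\<lambda>n t. \<Sum>k\<in>{m..<n}. \<alpha> k *\<^sub>R z k t)"
    have T: "norm (T n t) \<le> e" if "m \<le> n" "t \<in> {0..1}" for n t
      unfolding T_def using m0[of m n t] that by (simp add: m_def)
    have TD: "T n \<in> D01" for n
      unfolding T_def by (intro D01_weighted_sum zD) simp
    \<comment> \<open>The step from \<open>T n\<close> to \<open>T (Suc n)\<close> adds exactly the
      noise that the iteration subtracts, so the shifted error evolves by \<open>G\<close>
      alone.\<close>
    define y where "y = (\<lambda>n. sup_norm (\<lambda>t. x n t - xstar t + T n t))"
    have YD: "(\<lambda>t. x n t - xstar t + T n t) \<in> D01" for n
      using D01_lincomb[OF D01_diff[OF xD sD] TD, of 1 n 1 n] by simp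
    have dy: "\<delta> n \<le> y n + e" if n: "m \<le> n" for n
      unfolding \<delta>_def
    proof (rule sup_norm_le)
      fix t :: real
      assume t: "t \<in> {0..1}"
      have "norm (x n t - xstar t) \<le> norm (x n t - xstar t + T n t) + norm (T n t)"
        using norm_triangle_ineq4[of "x n t - xstar t + T n t" "T n t"] by simp
      also have "\<dots> \<le> y n + e"
        unfolding y_def using T[OF n t] norm_le_sup_norm[OF YD t] by (intro add_mono)
      finally show "norm (x n t - xstar t) \<le> y n + e" .
    qed
    \<comment> \<open>The raw bound is \<open>(1 - \<gamma> n) * y n + \<gamma> n * (e + \<rho> * (y
      n + e))\<close>. Collecting the terms in \<open>y n\<close> leaves the weight
      \<open>(1 - \<rho>) * \<gamma> n\<close>, and dividing the remainder
      \<open>\<gamma> n * (1 + \<rho>) * e\<close> by it gives the level.\<close>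
    have "y (Suc n) \<le> (1 - (1 - \<rho>) * \<gamma> n) * y n + ((1 - \<rho>) * \<gamma> n) * ((1 + \<rho>) / (1 - \<rho>) * e)"
      if n: "m \<le> n" for n
      \<comment> \<open>Only the instance at \<open>Suc n\<close> is unfolded: \<open>y n\<close> on
        the right remains a number, and the claim becomes a pointwise bound in
        \<open>t\<close>.\<close>
      unfolding y_def[THEN fun_cong, of "Suc n"]
    proof (rule sup_norm_le)
      fix t :: real
      assume t: "t \<in> {0..1}"
      \<comment> \<open>The residual of the contraction hypothesis. Solving for \<open>G\<close>
        gives \<open>\<theta>\<close> times the error plus \<open>H\<close>, which is how the step
        size \<open>\<gamma> n\<close> appears.\<close>
      define H where "H = (\<lambda>t. inverse \<theta> *\<^sub>R G (x n) t - (x n t - xstar t))"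
      have "H = (\<lambda>t. inverse \<theta> *\<^sub>R G (x n) t + (-1) *\<^sub>R (x n t - xstar t))"
        by (simp add: H_def fun_eq_iff)
      then have HD: "H \<in> D01"
        by (simp only: D01_lincomb[OF GD D01_diff[OF xD sD]])
      have "sup_norm H \<le> \<rho> * \<delta> n"
        unfolding H_def \<delta>_def by (rule contraction[OF x])
      then have H: "norm (H t) \<le> \<rho> * (y n + e)"
        using norm_le_sup_norm[OF HD t] mult_left_mono[OF dy[OF n], of \<rho>] rho by linarith
      have y: "norm (x n t - xstar t + T n t) \<le> y n"
        unfolding y_def by (rule norm_le_sup_norm[OF YD t])
      have g1: "\<gamma> n < 1" using m1[of n] n by (simp add: m_def)
      have "T (Suc n) t = T n t + \<alpha> n *\<^sub>R z n t"
        unfolding T_def using n by simp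
      moreover have "\<alpha> n *\<^sub>R G (x n) t = \<gamma> n *\<^sub>R (x n t - xstar t + H t)"
        using theta by (simp add: H_def \<gamma>_def)
      ultimately have "x (Suc n) t - xstar t + T (Suc n) t
          = (1 - \<gamma> n) *\<^sub>R (x n t - xstar t + T n t) + \<gamma> n *\<^sub>R (T n t - H t)"
        by (simp add: rec algebra_simps)
      then have "norm (x (Suc n) t - xstar t + T (Suc n) t)
          \<le> norm ((1 - \<gamma> n) *\<^sub>R (x n t - xstar t + T n t)) + norm (\<gamma> n *\<^sub>R (T n t - H t))"
        by (simp only: norm_triangle_ineq)
      also have "\<dots> = (1 - \<gamma> n) * norm (x n t - xstar t + T n t) + \<gamma> n * norm (T n t - H t)"
        using g1 g_pos[of n] by simp
      also have "\<dots> \<le> (1 - \<gamma> n) * y n + \<gamma> n * (e + \<rho> * (y n + e))"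
        using g1 g_pos[of n] y T[OF n t] H norm_triangle_ineq4[of "T n t" "H t"]
        by (intro add_mono mult_left_mono) auto
      also have "\<dots> = (1 - (1 - \<rho>) * \<gamma> n) * y n + ((1 - \<rho>) * \<gamma> n) * ((1 + \<rho>) / (1 - \<rho>) * e)"
        using rho by (simp add: field_simps)
      finally show "norm (x (Suc n) t - xstar t + T (Suc n) t) \<le> \<dots>" .
    qed
    moreover have "0 \<le> (1 - \<rho>) * \<gamma> n" if "m \<le> n" for n
      using rho g_pos by simp
    moreover have "(1 - \<rho>) * \<gamma> n \<le> 1" if "m \<le> n" for n
      using mult_mono[of "1 - \<rho>" 1 "\<gamma> n" 1] rho g_pos[of n] m1[of n] that by (simp add: m_def)
    moreover have "filterlim (\<lambda>n. \<Sum>k<n. (1 - \<rho>) * \<gamma> k) at_top sequentially"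
    proof -
      have "filterlim (\<lambda>n. ((1 - \<rho>) * \<theta>) * (\<Sum>k<n. \<alpha> k)) at_top sequentially"
        using rho theta
        by (intro filterlim_tendsto_pos_mult_at_top[OF tendsto_const _ alpha_sum]) simp
      then show ?thesis by (simp add: \<gamma>_def sum_distrib_left mult.assoc)
    qed
    ultimately have "\<forall>\<^sub>F n in sequentially. y n \<le> (1 + \<rho>) / (1 - \<rho>) * e + e"
      by (rule averaging_recursion_eventually_le[where m = m]) (use e in simp_all)
    then show ?thesis
      using eventually_ge_at_top[of m]
    proof eventually_elim
      case (elim n)
      then show ?case using dy[of n] by (simp add: algebra_simps)
    qed
  qed
  show ?thesis
    unfolding \<delta>_def[symmetric]
  proof (rule tendstoI)
    fix r :: real
    assume r: "0 < r"
    define c where "c = 2 + (1 + \<rho>) / (1 - \<rho>)"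
    have c: "0 < c" using rho by (simp add: c_def add_pos_pos)
    have "\<forall>\<^sub>F n in sequentially. \<delta> n \<le> c * (r / (2 * c))"
      by (rule main[folded c_def]) (use r c in simp)
    then show "\<forall>\<^sub>F n in sequentially. dist (\<delta> n) 0 < r"
    proof eventually_elim
      case (elim n)
      then show ?case using r c d_nonneg[of n] by simp
    qed
  qed
qed

subsection \<open>Processes and square integrability\<close>

lemma space_process_sigma [simp]: "space (process_sigma M Y I) = space M"
  by (auto simp: process_sigma_def intro!: space_measure_of)

lemma sets_process_sigma:
  "sets (process_sigma M Y I) =
     sigma_sets (space M) (\<Union>u\<in>I. {(\<lambda>\<omega>. Y \<omega> u) -` A \<inter> space M | A. A \<in> sets borel})"
  unfolding process_sigma_def by (rule sets_measure_of) auto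

lemma measurable_process_sigma [measurable]:
  assumes "u \<in> I"
  shows "(\<lambda>\<omega>. Y \<omega> u) \<in> borel_measurable (process_sigma M Y I)"
  by (rule measurableI) (use assms in \<open>auto simp: sets_process_sigma intro!: sigma_sets.Basic\<close>)

lemma sets_process_sigma_subset:
  assumes "\<And>u. u \<in> I \<Longrightarrow> (\<lambda>\<omega>. Y \<omega> u) \<in> borel_measurable N" "space N = space M"
  shows "sets (process_sigma M Y I) \<subseteq> sets N"
  unfolding sets_process_sigma assms(2)[symmetric]
  by (rule sets.sigma_sets_subset) (auto intro: measurable_sets[OF assms(1)])

lemma integrable_mult_square_integrable:
  fixes f g :: "'a \<Rightarrow> real"
  assumes [measurable]: "f \<in> borel_measurable M" "g \<in> borel_measurable M"
    and "integrable M (\<lambda>x. (f x)\<^sup>2)" "integrable M (\<lambda>x. (g x)\<^sup>2)"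
  shows "integrable M (\<lambda>x. f x * g x)"
proof (rule Bochner_Integration.integrable_bound)
  show "integrable M (\<lambda>x. (f x)\<^sup>2 + (g x)\<^sup>2)" using assms by auto
  have "\<bar>f x * g x\<bar> \<le> (f x)\<^sup>2 + (g x)\<^sup>2" for x
    using sum_squares_bound[of "\<bar>f x\<bar>" "\<bar>g x\<bar>"] mult_nonneg_nonneg[of "\<bar>f x\<bar>" "\<bar>g x\<bar>"]
    unfolding abs_mult power2_abs by linarith
  then show "AE x in M. norm (f x * g x) \<le> norm ((f x)\<^sup>2 + (g x)\<^sup>2)"
    by (auto intro: order_trans)
qed simp

lemma square_integrable_add:
  fixes f g :: "'a \<Rightarrow> real"
  assumes "f \<in> borel_measurable M" "g \<in> borel_measurable M"
    and "integrable M (\<lambda>x. (f x)\<^sup>2)" "integrable M (\<lambda>x. (g x)\<^sup>2)"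
  shows "integrable M (\<lambda>x. (f x + g x)\<^sup>2)"
  unfolding power2_sum
  using integrable_mult_square_integrable[OF assms] assms by (auto simp: mult.assoc)

lemma measurable_nth [measurable]:
  fixes f :: "'a \<Rightarrow> real ^ 'd"
  assumes "f \<in> borel_measurable N"
  shows "(\<lambda>x. f x $ i) \<in> borel_measurable N"
  using measurable_compose[OF assms, of "\<lambda>v. v $ i" borel]
  by (simp add: borel_measurable_continuous_onI continuous_on_component continuous_on_id)

lemma norm_power2_vec: "(norm (v :: real ^ 'd))\<^sup>2 = (\<Sum>i\<in>UNIV. (v $ i)\<^sup>2)"
  unfolding power2_norm_eq_inner inner_vec_def by (simp add: power2_eq_square)

text \<open>Path regularity is deliberately absent: all results of this context concern finitely or
  countably many times, and the passage to all times happens in the final theorem.\<close>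

locale independent_martingales = prob_space M for M :: "'w measure" +
  fixes Z :: "nat \<Rightarrow> 'w \<Rightarrow> real \<Rightarrow> real ^ 'd" and \<sigma> :: real
  assumes mart: "\<And>n. martingale01 M (Z n)"
    and indep: "indep_sets (\<lambda>n. sets (process_sigma M (Z n) {0..1})) UNIV"
    and zero: "\<And>n. AE \<omega> in M. Z n \<omega> 0 = 0"
    and var: "\<And>n. (\<integral>\<^sup>+\<omega>. ennreal ((norm (Z n \<omega> 1))\<^sup>2) \<partial>M) \<le> ennreal (\<sigma>\<^sup>2)"
begin

lemma integrable_Z: "t \<in> {0..1} \<Longrightarrow> integrable M (\<lambda>\<omega>. Z k \<omega> t)"
  using mart[of k] by (auto simp: martingale01_def)

lemma measurable_Z [measurable]: "t \<in> {0..1} \<Longrightarrow> (\<lambda>\<omega>. Z k \<omega> t) \<in> borel_measurable M"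
  using integrable_Z by auto

lemma integrable_Z_nth: "t \<in> {0..1} \<Longrightarrow> integrable M (\<lambda>\<omega>. Z k \<omega> t $ i)"
  using integrable_bounded_linear[OF bounded_linear_vec_nth integrable_Z] by auto

lemma measurable_Z_nth [measurable]: "t \<in> {0..1} \<Longrightarrow> (\<lambda>\<omega>. Z k \<omega> t $ i) \<in> borel_measurable M"
  using integrable_Z_nth by auto

lemma finite_measure_subalgebra_process_sigma:
  assumes "I \<subseteq> {0..1}"
  shows "finite_measure_subalgebra M (process_sigma M (Z k) I)"
proof
  have "sets (process_sigma M (Z k) I) \<subseteq> events"
    using assms by (intro sets_process_sigma_subset measurable_Z) auto
  then show "subalgebra M (process_sigma M (Z k) I)"
    by (simp add: subalgebra_def)
qed

lemma Z_cond_exp: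
  assumes "0 \<le> s" "s < 1"
  shows "AE \<omega> in M. real_cond_exp M (process_sigma M (Z k) {0..s}) (\<lambda>\<omega>. Z k \<omega> 1 $ i) \<omega> = Z k \<omega> s $ i"
proof -
  have "AE \<omega> in M. vec_cond_exp M (process_sigma M (Z k) {0..s}) (\<lambda>\<omega>'. Z k \<omega>' 1) \<omega> = Z k \<omega> s"
    using mart[of k] assms by (auto simp: martingale01_def)
  then show ?thesis
    by eventually_elim (auto simp: vec_cond_exp_def vec_eq_iff)
qed

lemma var_1:
  shows integrable_norm_Z_1: "integrable M (\<lambda>\<omega>. (norm (Z k \<omega> 1))\<^sup>2)"
    and expectation_norm_Z_1: "expectation (\<lambda>\<omega>. (norm (Z k \<omega> 1))\<^sup>2) \<le> \<sigma>\<^sup>2"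
proof -
  show *: "integrable M (\<lambda>\<omega>. (norm (Z k \<omega> 1))\<^sup>2)"
    using var[of k] by (intro integrableI_bounded) (auto simp: le_less_trans)
  have "ennreal (expectation (\<lambda>\<omega>. (norm (Z k \<omega> 1))\<^sup>2)) \<le> ennreal (\<sigma>\<^sup>2)"
    using var[of k] by (subst nn_integral_eq_integral[OF *, symmetric]) auto
  then show "expectation (\<lambda>\<omega>. (norm (Z k \<omega> 1))\<^sup>2) \<le> \<sigma>\<^sup>2"
    by simp
qed

text \<open>The variance bound speaks of time 1 only. Earlier values are conditional expectations of
  the value at 1, so conditional Jensen for the square carries integrability back to
  \<open>t\<close>.\<close>

lemma square_integrable_Z:
  assumes t: "t \<in> {0..1}"
  shows "integrable M (\<lambda>\<omega>. (Z k \<omega> t $ i)\<^sup>2)"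
proof -
  have 1: "integrable M (\<lambda>\<omega>. (Z k \<omega> 1 $ i)\<^sup>2)"
  proof (rule Bochner_Integration.integrable_bound[OF integrable_norm_Z_1[of k]])
    show "AE \<omega> in M. norm ((Z k \<omega> 1 $ i)\<^sup>2) \<le> norm ((norm (Z k \<omega> 1))\<^sup>2)"
      by (simp add: abs_le_square_iff[symmetric] component_le_norm_cart)
  qed simp
  show ?thesis
  proof (cases "t = 1")
    case False
    interpret F: finite_measure_subalgebra M "process_sigma M (Z k) {0..t}"
      using t by (intro finite_measure_subalgebra_process_sigma) auto
    have "integrable M (\<lambda>\<omega>. (real_cond_exp M (process_sigma M (Z k) {0..t}) (\<lambda>\<omega>. Z k \<omega> 1 $ i) \<omega>)\<^sup>2)"
    proof (rule F.integrable_convex_cond_exp[where I = UNIV])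
      show "convex_on UNIV (\<lambda>x::real. x\<^sup>2)"
        by (rule convex_power2)
    qed (simp_all add: 1 integrable_Z_nth)
    moreover have "AE \<omega> in M. (real_cond_exp M (process_sigma M (Z k) {0..t}) (\<lambda>\<omega>. Z k \<omega> 1 $ i) \<omega>)\<^sup>2
        = (Z k \<omega> t $ i)\<^sup>2"
      using Z_cond_exp[of t k i] t False by auto
    moreover have "(\<lambda>\<omega>. (Z k \<omega> t $ i)\<^sup>2) \<in> borel_measurable M"
      using t by measurable
    moreover have "(\<lambda>\<omega>. (real_cond_exp M (process_sigma M (Z k) {0..t}) (\<lambda>\<omega>. Z k \<omega> 1 $ i) \<omega>)\<^sup>2)
        \<in> borel_measurable M"
      by measurable
    ultimately show ?thesis
      using integrable_cong_AE by blast
  qed (use 1 in simp)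
qed

section \<open>Sigma-fields of whole paths and of partial pasts\<close>

definition hist :: "nat set \<Rightarrow> 'w measure" where
  "hist K = sigma (space M) (\<Union>k\<in>K. sets (process_sigma M (Z k) {0..1}))"

text \<open>The join of the past of \<open>Z k\<close> up to \<open>t\<close> with the whole paths
  indexed by \<open>K\<close>. It is generated by intersections and not by the union because these
  form a pi-system on which independence factorises expectations.\<close>

definition info :: "nat \<Rightarrow> real \<Rightarrow> nat set \<Rightarrow> 'w measure" where
  "info k t K =
     sigma (space M) {A \<inter> C | A C. A \<in> sets (process_sigma M (Z k) {0..t}) \<and> C \<in> sets (hist K)}"

lemma hist_gen: "(\<Union>k\<in>K. sets (process_sigma M (Z k) {0..1})) \<subseteq> Pow (space M)"
  using sets.sets_into_space by fastforce

lemma space_hist [simp]: "space (hist K) = space M"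
  unfolding hist_def by (intro space_measure_of hist_gen)

lemma sets_hist:
  "sets (hist K) = sigma_sets (space M) (\<Union>k\<in>K. sets (process_sigma M (Z k) {0..1}))"
  unfolding hist_def by (intro sets_measure_of hist_gen)

lemma sets_process_sigma_hist:
  assumes "k \<in> K" "I \<subseteq> {0..1}"
  shows "sets (process_sigma M (Z k) I) \<subseteq> sets (hist K)"
proof -
  have "sets (process_sigma M (Z k) I) \<subseteq> sets (process_sigma M (Z k) {0..1})"
    using assms(2) by (intro sets_process_sigma_subset) (rule measurable_process_sigma, auto)
  also have "\<dots> \<subseteq> sets (hist K)"
    using assms(1) by (auto simp: sets_hist intro: sigma_sets.Basic)
  finally show ?thesis .
qed

lemma measurable_Z_hist:
  assumes "k \<in> K" "t \<in> {0..1}"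
  shows "(\<lambda>\<omega>. Z k \<omega> t) \<in> borel_measurable (hist K)"
  by (rule measurable_from_subalg[OF _ measurable_process_sigma[OF assms(2)]])
    (use sets_process_sigma_hist[OF assms(1) order_refl] in \<open>simp add: subalgebra_def\<close>)

lemma sets_hist_events: "sets (hist K) \<subseteq> events"
proof -
  have "sets (process_sigma M (Z k) {0..1}) \<subseteq> events" for k
    by (intro sets_process_sigma_subset measurable_Z) auto
  then show ?thesis
    unfolding sets_hist by (intro sets.sigma_sets_subset) auto
qed

text \<open>Independent families stay independent when grouped over disjoint index sets;
  \<open>case_bool\<close> encodes the two groups in the form in which \<open>indep_set\<close> is
  defined.\<close>

lemma indep_hist:
  assumes "K \<inter> L = {}"
  shows "indep_set (sets (hist K)) (sets (hist L))"
proof -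
  have "indep_sets (\<lambda>b. sigma_sets (space M)
      (\<Union>k\<in>case_bool K L b. sets (process_sigma M (Z k) {0..1}))) UNIV"
  proof (rule indep_sets_collect_sigma)
    show "disjoint_family (case_bool K L)"
      using assms by (auto simp: disjoint_family_on_def split: bool.split)
  qed (auto intro: indep_sets_mono_index[OF _ indep] sets.Int_stable)
  also have "(\<lambda>b. sigma_sets (space M) (\<Union>k\<in>case_bool K L b. sets (process_sigma M (Z k) {0..1})))
      = case_bool (sets (hist K)) (sets (hist L))"
    by (auto simp: sets_hist fun_eq_iff split: bool.split)
  finally show ?thesis by (simp add: indep_set_def)
qed

lemma prob_hist_Int:
  assumes "K \<inter> L = {}" "A \<in> sets (hist K)" "C \<in> sets (hist L)"
  shows "prob (A \<inter> C) = prob A * prob C"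
  by (rule indep_setD[OF indep_hist[OF assms(1)] assms(2,3)])

lemma indep_var_hist:
  fixes f g :: "'w \<Rightarrow> real"
  assumes KL: "K \<inter> L = {}" and f: "f \<in> borel_measurable (hist K)" and g: "g \<in> borel_measurable (hist L)"
  shows "indep_var borel f borel g"
proof -
  have "f \<in> borel_measurable M" "g \<in> borel_measurable M"
    using f g sets_hist_events measurable_from_subalg[of M "hist _"] by (auto simp: subalgebra_def)
  moreover have "sigma_sets (space M) {f -` A \<inter> space M |A. A \<in> sets borel} \<subseteq> sets (hist K)"
    using measurable_sets[OF f] by (subst space_hist[of K, symmetric], intro sets.sigma_sets_subset) auto
  moreover have "sigma_sets (space M) {g -` A \<inter> space M |A. A \<in> sets borel} \<subseteq> sets (hist L)"
    using measurable_sets[OF g] by (subst space_hist[of L, symmetric], intro sets.sigma_sets_subset) auto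
  ultimately show ?thesis
    using indep_hist[OF KL] unfolding indep_var_eq indep_sets2_eq by blast
qed

lemma info_gen:
  "{A \<inter> C | A C. A \<in> sets (process_sigma M (Z k) {0..t}) \<and> C \<in> sets (hist K)} \<subseteq> Pow (space M)"
  using sets.sets_into_space[of _ "hist K"] by fastforce

lemma space_info [simp]: "space (info k t K) = space M"
  unfolding info_def by (intro space_measure_of info_gen)

lemma sets_info:
  "sets (info k t K) =
     sigma_sets (space M) {A \<inter> C | A C. A \<in> sets (process_sigma M (Z k) {0..t}) \<and> C \<in> sets (hist K)}"
  unfolding info_def by (intro sets_measure_of info_gen)

lemma sets_process_sigma_info: "sets (process_sigma M (Z k) {0..t}) \<subseteq> sets (info k t K)"
proof
  fix A
  assume A: "A \<in> sets (process_sigma M (Z k) {0..t})"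
  then have "A = A \<inter> space M"
    using sets.sets_into_space by fastforce
  moreover have "space M \<in> sets (hist K)"
    using sets.top[of "hist K"] by simp
  ultimately show "A \<in> sets (info k t K)"
    using A unfolding sets_info by blast
qed

lemma sets_hist_info: "sets (hist K) \<subseteq> sets (info k t K)"
proof
  fix C
  assume C: "C \<in> sets (hist K)"
  then have "C = space M \<inter> C"
    using sets.sets_into_space by fastforce
  moreover have "space M \<in> sets (process_sigma M (Z k) {0..t})"
    using sets.top[of "process_sigma M (Z k) {0..t}"] by simp
  ultimately show "C \<in> sets (info k t K)"
    using C unfolding sets_info by blast
qed

lemma measurable_Z_info:
  assumes "s \<in> {0..1}" and "l = k \<and> s \<le> t \<or> l \<in> K"
  shows "(\<lambda>\<omega>. Z l \<omega> s) \<in> borel_measurable (info k t K)"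
  using assms(2)
proof
  assume l: "l = k \<and> s \<le> t"
  then have "(\<lambda>\<omega>. Z l \<omega> s) \<in> borel_measurable (process_sigma M (Z k) {0..t})"
    using assms(1) by (auto intro: measurable_process_sigma)
  then show ?thesis
    by (rule measurable_from_subalg[rotated])
      (use sets_process_sigma_info[of k t K] in \<open>auto simp: subalgebra_def\<close>)
next
  assume "l \<in> K"
  from measurable_Z_hist[OF this assms(1)] show ?thesis
    by (rule measurable_from_subalg[rotated])
      (use sets_hist_info[of K k t] in \<open>auto simp: subalgebra_def\<close>)
qed

lemma finite_measure_subalgebra_info:
  assumes "t \<in> {0..1}"
  shows "finite_measure_subalgebra M (info k t K)"
proof
  have "sets (process_sigma M (Z k) {0..t}) \<subseteq> events"
    using assms by (intro sets_process_sigma_subset measurable_Z) auto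
  then have "sets (info k t K) \<subseteq> events"
    using sets_hist_events unfolding sets_info by (intro sets.sigma_sets_subset) blast
  then show "subalgebra M (info k t K)"
    by (simp add: subalgebra_def)
qed

section \<open>Orthogonality of martingale increments to the past and to the other paths\<close>

lemma increment_orthogonal_past:
  assumes t: "t \<in> {0..1}" and A: "A \<in> sets (process_sigma M (Z k) {0..t})"
  shows "expectation (\<lambda>\<omega>. indicator A \<omega> * (Z k \<omega> 1 $ i - Z k \<omega> t $ i)) = 0"
proof (cases "t = 1")
  case False
  interpret F: finite_measure_subalgebra M "process_sigma M (Z k) {0..t}"
    using t by (intro finite_measure_subalgebra_process_sigma) auto
  have A': "A \<in> events" using A F.subalg by (auto simp: subalgebra_def)
  \<comment> \<open>Since \<open>A\<close> belongs to the past, integrating over it does not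
    distinguish the value at time 1 from its conditional expectation, which is the value at
    \<open>t\<close> by the martingale property.\<close>
  have "expectation (\<lambda>\<omega>. indicator A \<omega> * Z k \<omega> 1 $ i)
      = (LINT \<omega>:A|M. real_cond_exp M (process_sigma M (Z k) {0..t}) (\<lambda>\<omega>. Z k \<omega> 1 $ i) \<omega>)"
    using F.real_cond_exp_intA[OF integrable_Z_nth A, of 1 k i]
    by (simp add: set_lebesgue_integral_def)
  also have "\<dots> = expectation (\<lambda>\<omega>. indicator A \<omega> * Z k \<omega> t $ i)"
    unfolding set_lebesgue_integral_def using Z_cond_exp[of t k i] t False A'
    by (intro integral_cong_AE) (auto simp: measurable_from_subalg)
  finally show ?thesis
    using integrable_mult_indicator[OF A' integrable_Z_nth] t
    by (simp add: right_diff_distrib)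
qed simp

text \<open>Here independence enlarges the sigma-field. On a generator \<open>A \<inter> C\<close>
  the increment times \<open>indicator A\<close> depends on \<open>Z k\<close> alone and
  \<open>indicator C\<close> on the paths in \<open>K\<close>, so the expectation factorises and the
  first factor vanishes. A Dynkin argument extends this to all of \<open>info k t K\<close>.\<close>

lemma increment_orthogonal_info:
  assumes t: "t \<in> {0..1}" and k: "k \<notin> K" and D: "D \<in> sets (info k t K)"
  shows "(LINT \<omega>:D|M. Z k \<omega> 1 $ i - Z k \<omega> t $ i) = 0"
proof -
  define d where "d = (\<lambda>\<omega>. Z k \<omega> 1 $ i - Z k \<omega> t $ i)"
  have d: "integrable M d"
    unfolding d_def using t by (intro Bochner_Integration.integrable_diff integrable_Z_nth) auto
  interpret I: finite_measure_subalgebra M "info k t K"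
    by (rule finite_measure_subalgebra_info[OF t])
  have ev: "A \<in> events" if "A \<in> sets (info k t K)" for A
    using that I.subalg by (auto simp: subalgebra_def)
  have ind: "integrable M (\<lambda>\<omega>. indicator A \<omega> * d \<omega>)" if "A \<in> sets (info k t K)" for A
    using integrable_mult_indicator[OF ev[OF that] d] by simp
  \<comment> \<open>The total mean has to vanish for the complement step of the Dynkin
    induction.\<close>
  have "expectation d = expectation (\<lambda>\<omega>. indicator (space M) \<omega> * d \<omega>)"
    by (intro Bochner_Integration.integral_cong) auto
  also have "\<dots> = 0"
    using increment_orthogonal_past[OF t, of "space M" k i] sets.top[of "process_sigma M (Z k) {0..t}"]
    by (simp add: d_def)
  finally have "expectation d = 0" .
  have "Int_stable {A \<inter> C | A C. A \<in> sets (process_sigma M (Z k) {0..t}) \<and> C \<in> sets (hist K)}"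
    (is "Int_stable ?G")
  proof (rule Int_stableI)
    fix a b
    assume "a \<in> ?G" "b \<in> ?G"
    then obtain A C A' C' where "a = A \<inter> C" "b = A' \<inter> C'"
      and *: "A \<in> sets (process_sigma M (Z k) {0..t})" "A' \<in> sets (process_sigma M (Z k) {0..t})"
        "C \<in> sets (hist K)" "C' \<in> sets (hist K)" by blast
    then have "a \<inter> b = (A \<inter> A') \<inter> (C \<inter> C')" by blast
    moreover have "A \<inter> A' \<in> sets (process_sigma M (Z k) {0..t})" "C \<inter> C' \<in> sets (hist K)"
      using * by auto
    ultimately show "a \<inter> b \<in> ?G" by blast
  qed
  from this info_gen D[unfolded sets_info] have "(LINT \<omega>:D|M. d \<omega>) = 0"
  proof (induction rule: sigma_sets_induct_disjoint)
    case (basic D)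
    then obtain A C where D: "D = A \<inter> C" and A: "A \<in> sets (process_sigma M (Z k) {0..t})"
      and C: "C \<in> sets (hist K)" by blast
    have A': "A \<in> sets (hist {k})"
      using A sets_process_sigma_hist[of k "{k}" "{0..t}"] t by auto
    have Ae: "A \<in> sets (info k t K)" using A sets_process_sigma_info by blast
    have Ce: "C \<in> sets (info k t K)" using C sets_hist_info by blast
    have dm: "d \<in> borel_measurable (hist {k})"
      unfolding d_def using measurable_Z_hist[of k "{k}" 1] measurable_Z_hist[of k "{k}" t] t
      by (intro borel_measurable_diff measurable_nth) auto
    have "(LINT \<omega>:D|M. d \<omega>) = expectation (\<lambda>\<omega>. (indicator A \<omega> * d \<omega>) * indicator C \<omega>)"
      unfolding set_lebesgue_integral_def D by (simp add: indicator_inter_arith ac_simps)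
    also have "\<dots> = expectation (\<lambda>\<omega>. indicator A \<omega> * d \<omega>) * expectation (indicator C)"
    proof (rule indep_var_lebesgue_integral)
      show "indep_var borel (\<lambda>\<omega>. indicator A \<omega> * d \<omega>) borel (indicator C)"
        using A' C dm k by (intro indep_var_hist[of "{k}" K]) auto
    qed (use ind[OF Ae] ev[OF Ce] in \<open>auto simp: integrable_indicator_iff less_top[symmetric]\<close>)
    also have "\<dots> = 0"
      using increment_orthogonal_past[OF t A, of i] by (simp add: d_def)
    finally show ?case .
  next
    case empty
    show ?case by (simp add: set_lebesgue_integral_def)
  next
    case (compl A)
    then have A: "A \<in> sets (info k t K)" by (simp add: sets_info)
    have "(LINT \<omega>:space M - A|M. d \<omega>) = expectation (\<lambda>\<omega>. d \<omega> - indicator A \<omega> * d \<omega>)"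
      unfolding set_lebesgue_integral_def
      by (intro Bochner_Integration.integral_cong) (auto simp: indicator_def)
    also have "\<dots> = 0"
      using compl(2) d ind[OF A] \<open>expectation d = 0\<close> by (simp add: set_lebesgue_integral_def)
    finally show ?case .
  next
    case (union A)
    then have A: "A n \<in> sets (info k t K)" for n by (auto simp: sets_info)
    then have "(\<Union>n. A n) \<in> sets (info k t K)" by auto
    from ind[OF this] have "set_integrable M (\<Union>n. A n) d"
      by (simp add: set_integrable_def)
    moreover have "A m \<inter> A n = {}" if "m \<noteq> n" for m n
      using union(1) that by (auto simp: disjoint_family_on_def)
    ultimately have "(LINT \<omega>:(\<Union>n. A n)|M. d \<omega>) = (\<Sum>n. LINT \<omega>:A n|M. d \<omega>)"
      using ev[OF A] by (intro lebesgue_integral_countable_add) auto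
    then show ?case using union(3) by simp
  qed
  then show ?thesis by (simp add: d_def)
qed

text \<open>Vanishing integrals over all events of \<open>info k t K\<close> say that the
  conditional expectation of the increment is zero, and the measurable factor \<open>f\<close> can
  be taken out of it.\<close>

lemma increment_orthogonal:
  assumes t: "t \<in> {0..1}" and k: "k \<notin> K" and f: "f \<in> borel_measurable (info k t K)"
    and int: "integrable M (\<lambda>\<omega>. f \<omega> * (Z k \<omega> 1 $ i - Z k \<omega> t $ i))"
  shows "expectation (\<lambda>\<omega>. f \<omega> * (Z k \<omega> 1 $ i - Z k \<omega> t $ i)) = 0"
proof -
  interpret I: finite_measure_subalgebra M "info k t K"
    by (rule finite_measure_subalgebra_info[OF t])
  have [measurable]: "(\<lambda>\<omega>. Z k \<omega> 1 $ i - Z k \<omega> t $ i) \<in> borel_measurable M"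
    using measurable_Z[of 1 k] measurable_Z[OF t, of k] by simp
  have [measurable]: "f \<in> borel_measurable M"
    by (rule measurable_from_subalg[OF I.subalg f])
  have "AE \<omega> in M. real_cond_exp M (info k t K) (\<lambda>\<omega>. Z k \<omega> 1 $ i - Z k \<omega> t $ i) \<omega> = 0"
    using increment_orthogonal_info[OF t k] t
    by (intro I.real_cond_exp_charact Bochner_Integration.integrable_diff integrable_Z_nth) auto
  then have "expectation (\<lambda>\<omega>. f \<omega> * real_cond_exp M (info k t K) (\<lambda>\<omega>. Z k \<omega> 1 $ i - Z k \<omega> t $ i) \<omega>) = 0"
    by (subst integral_cong_AE[where g = "\<lambda>_. 0"]) auto
  then show ?thesis
    using I.real_cond_exp_intg(2)[OF int f] by simp
qed

subsection \<open>Maximal inequalities for weighted sums\<close>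

definition wsum :: "(nat \<Rightarrow> real) \<Rightarrow> nat set \<Rightarrow> 'w \<Rightarrow> real \<Rightarrow> real ^ 'd" where
  "wsum c K \<omega> t = (\<Sum>k\<in>K. c k *\<^sub>R Z k \<omega> t)"

lemma measurable_wsum:
  assumes "\<And>k. k \<in> K \<Longrightarrow> (\<lambda>\<omega>. Z k \<omega> t) \<in> borel_measurable N"
  shows "(\<lambda>\<omega>. wsum c K \<omega> t) \<in> borel_measurable N"
  unfolding wsum_def by (intro borel_measurable_sum borel_measurable_scaleR assms) auto

lemma measurable_wsum_M [measurable]:
  "t \<in> {0..1} \<Longrightarrow> (\<lambda>\<omega>. wsum c K \<omega> t) \<in> borel_measurable M"
  by (intro measurable_wsum measurable_Z)

lemma square_integrable_wsum:
  assumes t: "t \<in> {0..1}"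
  shows "integrable M (\<lambda>\<omega>. (wsum c K \<omega> t $ i)\<^sup>2)"
proof (induction K rule: infinite_finite_induct)
  case (insert k K)
  have "integrable M (\<lambda>\<omega>. (c k * Z k \<omega> t $ i + wsum c K \<omega> t $ i)\<^sup>2)"
    using insert.IH square_integrable_Z[OF t, of k i] t
    by (intro square_integrable_add measurable_nth measurable_wsum_M borel_measurable_times
          measurable_Z_nth) (auto simp: power_mult_distrib)
  then show ?case
    using insert by (simp add: wsum_def)
qed (simp_all add: wsum_def)

lemma integrable_norm_wsum:
  assumes t: "t \<in> {0..1}"
  shows "integrable M (\<lambda>\<omega>. (norm (wsum c K \<omega> t))\<^sup>2)"
  unfolding norm_power2_vec by (intro Bochner_Integration.integrable_sum square_integrable_wsum t)

text \<open>Expanded in coordinates and summands, each term contains the increment of one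
  \<open>Z k\<close> times a factor depending on \<open>Z k\<close> up to \<open>t\<close> and on
  the other paths. The sigma-field thus varies with the term, which is why \<open>A\<close> is
  required to lie in one for every \<open>k\<close>.\<close>

lemma wsum_increment_orthogonal:
  assumes t: "t \<in> {0..1}" and A: "\<And>k. k \<in> K \<Longrightarrow> A \<in> sets (info k t (K - {k}))"
  shows "integrable M (\<lambda>\<omega>. indicator A \<omega> * (wsum c K \<omega> t \<bullet> (wsum c K \<omega> 1 - wsum c K \<omega> t)))" (is ?int)
    and "expectation (\<lambda>\<omega>. indicator A \<omega> * (wsum c K \<omega> t \<bullet> (wsum c K \<omega> 1 - wsum c K \<omega> t))) = 0" (is ?eq)
proof -
  have eq: "indicator A \<omega> * (wsum c K \<omega> t \<bullet> (wsum c K \<omega> 1 - wsum c K \<omega> t))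
      = (\<Sum>i\<in>UNIV. \<Sum>k\<in>K. c k * ((indicator A \<omega> * wsum c K \<omega> t $ i) * (Z k \<omega> 1 $ i - Z k \<omega> t $ i)))" for \<omega>
  proof -
    have "(wsum c K \<omega> 1 - wsum c K \<omega> t) $ i = (\<Sum>k\<in>K. c k * (Z k \<omega> 1 $ i - Z k \<omega> t $ i))" for i
      by (simp add: wsum_def right_diff_distrib sum_subtractf)
    then show ?thesis
      unfolding inner_vec_def by (simp add: sum_distrib_left ac_simps)
  qed
  have int: "integrable M (\<lambda>\<omega>. (indicator A \<omega> * wsum c K \<omega> t $ i) * (Z k \<omega> 1 $ i - Z k \<omega> t $ i))"
    if k: "k \<in> K" for k i
  proof -
    interpret I: finite_measure_subalgebra M "info k t (K - {k})"
      by (rule finite_measure_subalgebra_info[OF t])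
    have ev: "A \<in> events" using A[OF k] I.subalg by (auto simp: subalgebra_def)
    have sq: "(indicator A \<omega> * w)\<^sup>2 = indicator A \<omega> *\<^sub>R w\<^sup>2" for w :: real and \<omega>
      by (simp add: indicator_def)
    have "integrable M (\<lambda>\<omega>. (Z k \<omega> 1 $ i + - Z k \<omega> t $ i)\<^sup>2)"
      using square_integrable_Z[of _ k i] t
      by (intro square_integrable_add borel_measurable_uminus measurable_Z_nth) auto
    moreover have "integrable M (\<lambda>\<omega>. (indicator A \<omega> * wsum c K \<omega> t $ i)\<^sup>2)"
      unfolding sq by (rule integrable_mult_indicator[OF ev square_integrable_wsum[OF t]])
    ultimately show ?thesis
      using ev t by (intro integrable_mult_square_integrable) auto
  qed
  then show ?int
    unfolding eq by (intro Bochner_Integration.integrable_sum integrable_mult_right) 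
  have "expectation (\<lambda>\<omega>. (indicator A \<omega> * wsum c K \<omega> t $ i) * (Z k \<omega> 1 $ i - Z k \<omega> t $ i)) = 0"
    if k: "k \<in> K" for k i
  proof (rule increment_orthogonal[OF t, of k "K - {k}"])
    have "(\<lambda>\<omega>. wsum c K \<omega> t) \<in> borel_measurable (info k t (K - {k}))"
      using t by (intro measurable_wsum measurable_Z_info) auto
    then show "(\<lambda>\<omega>. indicator A \<omega> * wsum c K \<omega> t $ i) \<in> borel_measurable (info k t (K - {k}))"
      using A[OF k] by (intro borel_measurable_times measurable_nth) auto
  qed (use int[OF k] in auto)
  then show ?eq
    unfolding eq using int by (simp add: Bochner_Integration.integral_sum Bochner_Integration.integrable_sum)
qed

text \<open>Orthogonality between different indices is the case \<open>t = 0\<close> of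
  orthogonality in time: \<open>info k 0 K\<close> contains the whole paths of \<open>K\<close>, and
  the increment of \<open>Z k\<close> from 0 to 1 is its value at 1 almost everywhere.\<close>

lemma expectation_norm_wsum:
  assumes "finite K"
  shows "expectation (\<lambda>\<omega>. (norm (wsum c K \<omega> 1))\<^sup>2) \<le> \<sigma>\<^sup>2 * (\<Sum>k\<in>K. (c k)\<^sup>2)"
  using assms
proof (induction K)
  case empty
  show ?case by (simp add: wsum_def)
next
  case (insert k K)
  have int: "integrable M (\<lambda>\<omega>. wsum c K \<omega> 1 $ i * Z k \<omega> s $ i)" if "s \<in> {0..1}" for i s
    using that by (intro integrable_mult_square_integrable square_integrable_wsum square_integrable_Z
        measurable_nth measurable_wsum_M measurable_Z) auto
  have "expectation (\<lambda>\<omega>. wsum c K \<omega> 1 $ i * Z k \<omega> 1 $ i) = 0" for i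
  proof -
    have "expectation (\<lambda>\<omega>. wsum c K \<omega> 1 $ i * (Z k \<omega> 1 $ i - Z k \<omega> 0 $ i)) = 0"
    proof (rule increment_orthogonal[of 0 k K])
      show "(\<lambda>\<omega>. wsum c K \<omega> 1 $ i) \<in> borel_measurable (info k 0 K)"
        by (intro measurable_nth measurable_wsum measurable_Z_info) auto
    qed (use insert int[of 0 i] int[of 1 i] in \<open>auto simp: right_diff_distrib\<close>)
    moreover have "expectation (\<lambda>\<omega>. wsum c K \<omega> 1 $ i * (Z k \<omega> 1 $ i - Z k \<omega> 0 $ i))
        = expectation (\<lambda>\<omega>. wsum c K \<omega> 1 $ i * Z k \<omega> 1 $ i)"
      using zero[of k] by (intro integral_cong_AE) auto
    ultimately show ?thesis by simp
  qed
  then have cross: "expectation (\<lambda>\<omega>. wsum c K \<omega> 1 \<bullet> Z k \<omega> 1) = 0"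
    and int_cross: "integrable M (\<lambda>\<omega>. wsum c K \<omega> 1 \<bullet> Z k \<omega> 1)"
    using int[of 1] by (simp_all add: inner_vec_def)
  have "(norm (wsum c (insert k K) \<omega> 1))\<^sup>2 = (c k)\<^sup>2 * (norm (Z k \<omega> 1))\<^sup>2
      + 2 * c k * (wsum c K \<omega> 1 \<bullet> Z k \<omega> 1) + (norm (wsum c K \<omega> 1))\<^sup>2" for \<omega>
  proof -
    have "wsum c (insert k K) \<omega> 1 = c k *\<^sub>R Z k \<omega> 1 + wsum c K \<omega> 1"
      using insert by (simp add: wsum_def)
    then show ?thesis
      unfolding power2_norm_eq_inner power2_eq_square[of "c k"]
      by (simp add: inner_add_left inner_add_right inner_commute algebra_simps)
  qed
  then have "expectation (\<lambda>\<omega>. (norm (wsum c (insert k K) \<omega> 1))\<^sup>2)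
      = (c k)\<^sup>2 * expectation (\<lambda>\<omega>. (norm (Z k \<omega> 1))\<^sup>2) + expectation (\<lambda>\<omega>. (norm (wsum c K \<omega> 1))\<^sup>2)"
    using int_cross cross integrable_norm_Z_1[of k] integrable_norm_wsum[of 1 c K] by simp
  also have "\<dots> \<le> (c k)\<^sup>2 * \<sigma>\<^sup>2 + \<sigma>\<^sup>2 * (\<Sum>k\<in>K. (c k)\<^sup>2)"
    using insert.IH expectation_norm_Z_1[of k] by (intro add_mono mult_left_mono) auto
  finally show ?case
    using insert by (simp add: algebra_simps)
qed

text \<open>Split by the first time in \<open>J\<close> at which the norm reaches \<open>l\<close>.
  That event is decided by time \<open>t\<close>, so the later increment is orthogonal to the value
  at \<open>t\<close> on it, and the second moment at time 1 over the event is at least its share at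
  \<open>t\<close>.\<close>

lemma maximal_inequality_time:
  assumes K: "finite K" and J: "finite J" "J \<subseteq> {0..1}" and l: "0 < l"
  shows "prob {\<omega> \<in> space M. \<exists>t\<in>J. l \<le> norm (wsum c K \<omega> t)} \<le> \<sigma>\<^sup>2 * (\<Sum>k\<in>K. (c k)\<^sup>2) / l\<^sup>2"
proof -
  define A where "A = (\<lambda>t. {\<omega> \<in> space M. l \<le> norm (wsum c K \<omega> t) \<and> (\<forall>s\<in>J. s < t \<longrightarrow> norm (wsum c K \<omega> s) < l)})"
  \<comment> \<open>The sigma-field \<open>N\<close> is left open because the claim is used twice:
    for plain measurability, and for membership in \<open>info\<close>.\<close>
  have A_sets: "A t \<in> sets N"
    if "space N = space M" "\<And>s. s \<in> J \<Longrightarrow> s \<le> t \<Longrightarrow> (\<lambda>\<omega>. wsum c K \<omega> s) \<in> borel_measurable N" "t \<in> J" for t N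
  proof -
    have "{\<omega> \<in> space N. l \<le> norm (wsum c K \<omega> t) \<and> (\<forall>s\<in>{s\<in>J. s < t}. norm (wsum c K \<omega> s) < l)} \<in> sets N"
      using J that by (intro sets.sets_Collect_conj sets.sets_Collect_finite_All
          borel_measurable_le borel_measurable_less) auto
    moreover have "A t = {\<omega> \<in> space N. l \<le> norm (wsum c K \<omega> t) \<and> (\<forall>s\<in>{s\<in>J. s < t}. norm (wsum c K \<omega> s) < l)}"
      by (auto simp: A_def that(1))
    ultimately show ?thesis by simp
  qed
  have A_ev: "A t \<in> events" if "t \<in> J" for t
    using that J by (intro A_sets measurable_wsum_M) auto
  have A_info: "A t \<in> sets (info k t (K - {k}))" if "t \<in> J" for t k
    using that J by (intro A_sets measurable_wsum measurable_Z_info) auto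
  have disj: "disjoint_family_on A J"
    unfolding disjoint_family_on_def
  proof (intro ballI impI)
    fix s t
    assume "s \<in> J" "t \<in> J" "s \<noteq> t"
    then show "A s \<inter> A t = {}"
      by (cases s t rule: linorder_cases) (auto simp: A_def)
  qed
  have UN: "{\<omega> \<in> space M. \<exists>t\<in>J. l \<le> norm (wsum c K \<omega> t)} = (\<Union>t\<in>J. A t)"
  proof (intro subset_antisym subsetI)
    fix \<omega>
    assume "\<omega> \<in> {\<omega> \<in> space M. \<exists>t\<in>J. l \<le> norm (wsum c K \<omega> t)}"
    then have \<omega>: "\<omega> \<in> space M" and ne: "{t\<in>J. l \<le> norm (wsum c K \<omega> t)} \<noteq> {}" by auto
    define t where "t = Min {t\<in>J. l \<le> norm (wsum c K \<omega> t)}"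
    have "t \<in> {t\<in>J. l \<le> norm (wsum c K \<omega> t)}"
      unfolding t_def using J(1) ne by (intro Min_in) auto
    moreover have "norm (wsum c K \<omega> s) < l" if "s \<in> J" "s < t" for s
    proof (rule ccontr)
      assume "\<not> ?thesis"
      then have "t \<le> s" unfolding t_def using J(1) that by (intro Min_le) auto
      then show False using that by simp
    qed
    ultimately show "\<omega> \<in> (\<Union>t\<in>J. A t)"
      using \<omega> by (auto simp: A_def)
  qed (auto simp: A_def)
  have int1: "integrable M (\<lambda>\<omega>. indicator (A t) \<omega> * (norm (wsum c K \<omega> 1))\<^sup>2)" if "t \<in> J" for t
    using integrable_mult_indicator[OF A_ev[OF that] integrable_norm_wsum[of 1 c K]] by simp
  have le: "l\<^sup>2 * prob (A t) \<le> expectation (\<lambda>\<omega>. indicator (A t) \<omega> * (norm (wsum c K \<omega> 1))\<^sup>2)"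
    if t: "t \<in> J" for t
  proof -
    have t01: "t \<in> {0..1}" using t J by auto
    \<comment> \<open>The cross term in the expansion of the squared norm at time 1 around time
      \<open>t\<close>. It has mean zero, so subtracting \<open>2 * g\<close> below changes no
      expectation but makes the inequality pointwise.\<close>
    define g where "g = (\<lambda>\<omega>. indicator (A t) \<omega> * (wsum c K \<omega> t \<bullet> (wsum c K \<omega> 1 - wsum c K \<omega> t)) :: real)"
    have g: "integrable M g" "expectation g = 0"
      unfolding g_def using wsum_increment_orthogonal[OF t01 A_info[OF t]] by auto
    have "l\<^sup>2 * prob (A t) = expectation (\<lambda>\<omega>. l\<^sup>2 * indicator (A t) \<omega>)"
      using A_ev[OF t] by (simp add: sets.Int_space_eq2)
    also have "\<dots> \<le> expectation (\<lambda>\<omega>. indicator (A t) \<omega> * (norm (wsum c K \<omega> 1))\<^sup>2 - 2 * g \<omega>)"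
    proof (rule integral_mono)
      show "integrable M (\<lambda>\<omega>. l\<^sup>2 * indicator (A t) \<omega>)"
        using A_ev[OF t] by (auto simp: integrable_indicator_iff less_top[symmetric])
      show "integrable M (\<lambda>\<omega>. indicator (A t) \<omega> * (norm (wsum c K \<omega> 1))\<^sup>2 - 2 * g \<omega>)"
        using int1[OF t] g(1) by auto
      fix \<omega>
      show "l\<^sup>2 * indicator (A t) \<omega> \<le> indicator (A t) \<omega> * (norm (wsum c K \<omega> 1))\<^sup>2 - 2 * g \<omega>"
      proof (cases "\<omega> \<in> A t")
        case True
        then have "l \<le> norm (wsum c K \<omega> t)" by (simp add: A_def)
        then have "l\<^sup>2 \<le> (norm (wsum c K \<omega> t))\<^sup>2" using l by (intro power_mono) auto
        moreover have "(norm (wsum c K \<omega> 1))\<^sup>2 = (norm (wsum c K \<omega> t))\<^sup>2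
            + 2 * (wsum c K \<omega> t \<bullet> (wsum c K \<omega> 1 - wsum c K \<omega> t)) + (norm (wsum c K \<omega> 1 - wsum c K \<omega> t))\<^sup>2"
          by (simp add: power2_norm_eq_inner inner_diff_left inner_diff_right inner_commute)
        ultimately have "l\<^sup>2 \<le> (norm (wsum c K \<omega> 1))\<^sup>2 - 2 * (wsum c K \<omega> t \<bullet> (wsum c K \<omega> 1 - wsum c K \<omega> t))"
          using zero_le_power2[of "norm (wsum c K \<omega> 1 - wsum c K \<omega> t)"] by linarith
        then show ?thesis
          using True by (simp add: g_def)
      qed (simp add: g_def)
    qed
    also have "\<dots> = expectation (\<lambda>\<omega>. indicator (A t) \<omega> * (norm (wsum c K \<omega> 1))\<^sup>2)"
      using int1[OF t] g by simp
    finally show ?thesis .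
  qed
  have "l\<^sup>2 * prob (\<Union>t\<in>J. A t) = (\<Sum>t\<in>J. l\<^sup>2 * prob (A t))"
    using A_ev J(1) disj by (subst finite_measure_finite_Union) (auto simp: sum_distrib_left)
  also have "\<dots> \<le> (\<Sum>t\<in>J. expectation (\<lambda>\<omega>. indicator (A t) \<omega> * (norm (wsum c K \<omega> 1))\<^sup>2))"
    by (intro sum_mono le)
  also have "\<dots> = expectation (\<lambda>\<omega>. \<Sum>t\<in>J. indicator (A t) \<omega> * (norm (wsum c K \<omega> 1))\<^sup>2)"
    using int1 by simp
  also have "\<dots> \<le> expectation (\<lambda>\<omega>. (norm (wsum c K \<omega> 1))\<^sup>2)"
  proof (rule integral_mono)
    show "integrable M (\<lambda>\<omega>. \<Sum>t\<in>J. indicator (A t) \<omega> * (norm (wsum c K \<omega> 1))\<^sup>2)"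
      using int1 by auto
    show "integrable M (\<lambda>\<omega>. (norm (wsum c K \<omega> 1))\<^sup>2)"
      by (rule integrable_norm_wsum) simp
    fix \<omega>
    have "indicator (\<Union>t\<in>J. A t) \<omega> = (\<Sum>t\<in>J. indicator (A t) \<omega> :: real)"
      by (rule indicator_UN_disjoint[OF J(1) disj])
    then have "(\<Sum>t\<in>J. indicator (A t) \<omega> * (norm (wsum c K \<omega> 1))\<^sup>2)
        = indicator (\<Union>t\<in>J. A t) \<omega> * (norm (wsum c K \<omega> 1))\<^sup>2"
      by (simp add: sum_distrib_right)
    also have "\<dots> \<le> (norm (wsum c K \<omega> 1))\<^sup>2"
      by (simp add: indicator_def)
    finally show "(\<Sum>t\<in>J. indicator (A t) \<omega> * (norm (wsum c K \<omega> 1))\<^sup>2) \<le> (norm (wsum c K \<omega> 1))\<^sup>2" .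
  qed
  also have "\<dots> \<le> \<sigma>\<^sup>2 * (\<Sum>k\<in>K. (c k)\<^sup>2)"
    by (rule expectation_norm_wsum[OF K])
  finally show ?thesis
    unfolding UN using l by (simp add: field_simps)
qed

section \<open>Maximum over time and over the number of terms\<close>

lemma wsum_atLeastLessThan_concat:
  assumes "m \<le> k" "k \<le> n"
  shows "wsum c {m..<n} \<omega> t = wsum c {m..<k} \<omega> t + wsum c {k..<n} \<omega> t"
  unfolding wsum_def by (rule sum.atLeastLessThan_concat[OF assms, symmetric])

lemma measurable_wsum_hist:
  assumes "K \<subseteq> L" "t \<in> {0..1}"
  shows "(\<lambda>\<omega>. wsum c K \<omega> t) \<in> borel_measurable (hist L)"
  using assms by (intro measurable_wsum measurable_Z_hist) auto

text \<open>If a partial sum reaches \<open>2 * l\<close> and the rest of the sum stays below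
  \<open>l\<close>, the full sum reaches \<open>l\<close> at the same time. First passage in
  \<open>k\<close> uses only the terms before \<open>k\<close>, the rest only later ones, so the two
  are independent; \<open>small\<close> makes the second have probability at least one half, whence
  the factor 2.\<close>

lemma maximal_inequality:
  assumes J: "finite J" "J \<subseteq> {0..1}" and l: "0 < l"
    and small: "2 * (\<sigma>\<^sup>2 * (\<Sum>k\<in>{m..<n}. (c k)\<^sup>2)) \<le> l\<^sup>2"
  shows "prob {\<omega> \<in> space M. \<exists>k\<in>{m..n}. \<exists>t\<in>J. 2 * l \<le> norm (wsum c {m..<k} \<omega> t)}
    \<le> 2 * (\<sigma>\<^sup>2 * (\<Sum>k\<in>{m..<n}. (c k)\<^sup>2)) / l\<^sup>2"
proof -
  define v where "v = \<sigma>\<^sup>2 * (\<Sum>k\<in>{m..<n}. (c k)\<^sup>2)"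
  define A where "A = (\<lambda>k. {\<omega> \<in> space M. (\<exists>t\<in>J. 2 * l \<le> norm (wsum c {m..<k} \<omega> t)) \<and>
      (\<forall>j\<in>{m..<k}. \<forall>t\<in>J. norm (wsum c {m..<j} \<omega> t) < 2 * l)})"
  \<comment> \<open>All times of \<open>J\<close> are included because the time at which the partial
    sum is large depends on the outcome.\<close>
  define C where "C = (\<lambda>k. {\<omega> \<in> space M. \<forall>t\<in>J. norm (wsum c {k..<n} \<omega> t) < l})"
  define F where "F = {\<omega> \<in> space M. \<exists>t\<in>J. l \<le> norm (wsum c {m..<n} \<omega> t)}"
  have A_hist: "A k \<in> sets (hist {m..<k})" for k
  proof -
    have [measurable]: "(\<lambda>\<omega>. norm (wsum c {m..<j} \<omega> t)) \<in> borel_measurable (hist {m..<k})"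
      if "j \<le> k" "t \<in> J" for j t
      by (rule measurable_compose[OF measurable_wsum_hist borel_measurable_norm]) (use J that in auto)
    have "{\<omega> \<in> space (hist {m..<k}). (\<exists>t\<in>J. 2 * l \<le> norm (wsum c {m..<k} \<omega> t)) \<and>
        (\<forall>j\<in>{m..<k}. \<forall>t\<in>J. norm (wsum c {m..<j} \<omega> t) < 2 * l)} \<in> sets (hist {m..<k})"
      using J(1) by (intro sets.sets_Collect_conj sets.sets_Collect_finite_All sets.sets_Collect_finite_Ex
          borel_measurable_le borel_measurable_less) auto
    then show ?thesis by (simp add: A_def)
  qed
  have C_hist: "C k \<in> sets (hist {k..<n})" for k
  proof -
    have "{\<omega> \<in> space (hist {k..<n}). \<forall>t\<in>J. norm (wsum c {k..<n} \<omega> t) < l} \<in> sets (hist {k..<n})"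
      using J by (intro sets.sets_Collect_finite_All borel_measurable_less
          measurable_compose[OF measurable_wsum_hist borel_measurable_norm]) auto
    then show ?thesis by (simp add: C_def)
  qed
  have A_ev: "A k \<in> events" and C_ev: "C k \<in> events" for k
    using A_hist C_hist sets_hist_events by blast+
  have F_ev: "F \<in> events"
    unfolding F_def using J
    by (intro sets.sets_Collect_finite_Ex borel_measurable_le measurable_compose[OF measurable_wsum_M borel_measurable_norm]) auto
  have A_less: "A i \<inter> A j = {}" if "m \<le> i" "i < j" for i j
  proof (rule equals0I)
    fix \<omega>
    assume "\<omega> \<in> A i \<inter> A j"
    then obtain t where "t \<in> J" "2 * l \<le> norm (wsum c {m..<i} \<omega> t)"
      and "\<forall>i\<in>{m..<j}. \<forall>t\<in>J. norm (wsum c {m..<i} \<omega> t) < 2 * l"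
      by (auto simp: A_def)
    moreover have "i \<in> {m..<j}" using that by simp
    ultimately show False by (meson not_le)
  qed
  have disj: "disjoint_family_on A {m..n}"
    unfolding disjoint_family_on_def
  proof (intro ballI impI)
    fix i j
    assume "i \<in> {m..n}" "j \<in> {m..n}" "i \<noteq> j"
    then show "A i \<inter> A j = {}"
      using A_less[of i j] A_less[of j i] by (cases i j rule: linorder_cases) (auto simp: Int_commute)
  qed
  then have disj': "disjoint_family_on (\<lambda>k. A k \<inter> C k) {m..n}"
    unfolding disjoint_family_on_def by blast
  have UN: "{\<omega> \<in> space M. \<exists>k\<in>{m..n}. \<exists>t\<in>J. 2 * l \<le> norm (wsum c {m..<k} \<omega> t)} = (\<Union>k\<in>{m..n}. A k)"
  proof (intro subset_antisym subsetI)
    fix \<omega>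
    assume "\<omega> \<in> {\<omega> \<in> space M. \<exists>k\<in>{m..n}. \<exists>t\<in>J. 2 * l \<le> norm (wsum c {m..<k} \<omega> t)}"
    then obtain k where \<omega>: "\<omega> \<in> space M" and k: "k \<in> {m..n}" "\<exists>t\<in>J. 2 * l \<le> norm (wsum c {m..<k} \<omega> t)"
      by blast
    define P where "P = (\<lambda>k. k \<in> {m..n} \<and> (\<exists>t\<in>J. 2 * l \<le> norm (wsum c {m..<k} \<omega> t)))"
    have "P (LEAST k. P k)"
      by (rule LeastI[of P k]) (use k in \<open>simp add: P_def\<close>)
    moreover have "norm (wsum c {m..<j} \<omega> t) < 2 * l" if "j \<in> {m..<(LEAST k. P k)}" "t \<in> J" for j t
    proof -
      have "\<not> P j" using not_less_Least[of j P] that by simp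
      moreover have "j \<in> {m..n}" using \<open>P (LEAST k. P k)\<close> that by (auto simp: P_def)
      ultimately show ?thesis using that by (auto simp: P_def)
    qed
    ultimately show "\<omega> \<in> (\<Union>k\<in>{m..n}. A k)"
      using \<omega> by (auto simp: A_def P_def)
  qed (auto simp: A_def)
  \<comment> \<open>The tail sum obeys the inequality in time with at most the variance of the full
    block, and \<open>small\<close> makes that bound at most one half.\<close>
  have half: "1 / 2 \<le> prob (C k)" if k: "k \<in> {m..n}" for k
  proof -
    have "{\<omega> \<in> space M. \<not> (\<exists>t\<in>J. l \<le> norm (wsum c {k..<n} \<omega> t))} = C k"
      by (auto simp: C_def not_le)
    then have "prob (C k) = 1 - prob {\<omega> \<in> space M. \<exists>t\<in>J. l \<le> norm (wsum c {k..<n} \<omega> t)}"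
      using J by (subst prob_neg[symmetric]) (auto intro!: sets.sets_Collect_finite_Ex
          borel_measurable_le measurable_compose[OF measurable_wsum_M borel_measurable_norm])
    moreover have "prob {\<omega> \<in> space M. \<exists>t\<in>J. l \<le> norm (wsum c {k..<n} \<omega> t)}
        \<le> \<sigma>\<^sup>2 * (\<Sum>k\<in>{k..<n}. (c k)\<^sup>2) / l\<^sup>2"
      by (rule maximal_inequality_time[OF _ J l]) simp
    moreover have "\<sigma>\<^sup>2 * (\<Sum>k\<in>{k..<n}. (c k)\<^sup>2) \<le> v"
      unfolding v_def using k by (intro mult_left_mono sum_mono2) auto
    then have "\<sigma>\<^sup>2 * (\<Sum>k\<in>{k..<n}. (c k)\<^sup>2) / l\<^sup>2 \<le> 1 / 2"
      using small l by (simp add: v_def field_simps)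
    ultimately show ?thesis by linarith
  qed
  have "prob (\<Union>k\<in>{m..n}. A k) = (\<Sum>k\<in>{m..n}. prob (A k))"
    using A_ev disj by (intro finite_measure_finite_Union) auto
  also have "\<dots> \<le> (\<Sum>k\<in>{m..n}. 2 * prob (A k \<inter> C k))"
  proof (rule sum_mono)
    fix k
    assume k: "k \<in> {m..n}"
    have "prob (A k \<inter> C k) = prob (A k) * prob (C k)"
      by (rule prob_hist_Int[OF _ A_hist C_hist]) auto
    moreover have "prob (A k) * (1 / 2) \<le> prob (A k) * prob (C k)"
      using half[OF k] by (intro mult_left_mono) auto
    ultimately show "prob (A k) \<le> 2 * prob (A k \<inter> C k)" by simp
  qed
  also have "\<dots> = 2 * prob (\<Union>k\<in>{m..n}. A k \<inter> C k)"
    using A_ev C_ev disj'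
    by (subst finite_measure_finite_Union[of _ "\<lambda>k. A k \<inter> C k"]) (auto simp: sum_distrib_left)
  also have "prob (\<Union>k\<in>{m..n}. A k \<inter> C k) \<le> prob F"
  proof (rule finite_measure_mono[OF _ F_ev])
    show "(\<Union>k\<in>{m..n}. A k \<inter> C k) \<subseteq> F"
    proof
      fix \<omega>
      assume "\<omega> \<in> (\<Union>k\<in>{m..n}. A k \<inter> C k)"
      then obtain k t where k: "k \<in> {m..n}" and t: "t \<in> J" and \<omega>: "\<omega> \<in> space M"
        and "2 * l \<le> norm (wsum c {m..<k} \<omega> t)" "norm (wsum c {k..<n} \<omega> t) < l"
        by (auto simp: A_def C_def)
      then have "l \<le> norm (wsum c {m..<n} \<omega> t)"
        using wsum_atLeastLessThan_concat[of m k n c \<omega> t]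
          norm_diff_ineq[of "wsum c {m..<k} \<omega> t" "wsum c {k..<n} \<omega> t"] by simp
      then show "\<omega> \<in> F" using t \<omega> by (auto simp: F_def)
    qed
  qed
  also have "prob F \<le> v / l\<^sup>2"
    unfolding F_def v_def by (rule maximal_inequality_time[OF _ J l]) simp
  finally show ?thesis
    unfolding UN v_def by simp
qed

text \<open>The finite bound involves only \<open>v\<close>, uniformly in the number of terms and of
  times, so continuity of the measure from below gives the countable case.\<close>

lemma maximal_inequality_countable:
  assumes D: "countable D" "D \<subseteq> {0..1}" and l: "0 < l"
    and v: "\<And>n. \<sigma>\<^sup>2 * (\<Sum>k\<in>{m..<n}. (c k)\<^sup>2) \<le> v" and small: "2 * v \<le> l\<^sup>2"
  shows "prob {\<omega> \<in> space M. \<exists>k\<ge>m. \<exists>t\<in>D. 2 * l \<le> norm (wsum c {m..<k} \<omega> t)} \<le> 2 * v / l\<^sup>2"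
proof (cases "D = {}")
  case True
  have "0 \<le> v" using v[of m] by simp
  then show ?thesis using True by simp
next
  case False
  define J where "J = (\<lambda>n. from_nat_into D ` {..n})"
  have J: "finite (J n)" "J n \<subseteq> {0..1}" for n
    using D(2) from_nat_into[OF False] by (auto simp: J_def)
  have D_eq: "D = (\<Union>n. J n)"
    unfolding J_def image_UN[symmetric] UN_atMost_UNIV range_from_nat_into[OF False D(1)] ..
  \<comment> \<open>One index \<open>n\<close> truncates both the terms and the enumeration of
    \<open>D\<close>, so that a single increasing sequence exhausts the event.\<close>
  define E where "E = (\<lambda>n. {\<omega> \<in> space M. \<exists>k\<in>{m..n}. \<exists>t\<in>J n. 2 * l \<le> norm (wsum c {m..<k} \<omega> t)})"
  have E_ev: "E n \<in> events" for n
    unfolding E_def using J[of n]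
    by (intro sets.sets_Collect_finite_Ex borel_measurable_le measurable_compose[OF measurable_wsum_M borel_measurable_norm]) auto
  have J_mono: "J n \<subseteq> J n'" if "n \<le> n'" for n n'
    using that by (auto simp: J_def)
  then have "incseq E"
    unfolding incseq_def E_def by fastforce
  then have "(\<lambda>n. prob (E n)) \<longlonglongrightarrow> prob (\<Union>n. E n)"
    using E_ev by (intro finite_Lim_measure_incseq) auto
  moreover have "prob (E n) \<le> 2 * v / l\<^sup>2" for n
  proof -
    have "prob (E n) \<le> 2 * (\<sigma>\<^sup>2 * (\<Sum>k\<in>{m..<n}. (c k)\<^sup>2)) / l\<^sup>2"
      unfolding E_def using v[of n] small by (intro maximal_inequality J l) auto
    also have "\<dots> \<le> 2 * v / l\<^sup>2"
      using v[of n] l by (intro divide_right_mono) auto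
    finally show ?thesis .
  qed
  ultimately have "prob (\<Union>n. E n) \<le> 2 * v / l\<^sup>2"
    by (intro LIMSEQ_le_const2) auto
  moreover have "(\<Union>n. E n) = {\<omega> \<in> space M. \<exists>k\<ge>m. \<exists>t\<in>D. 2 * l \<le> norm (wsum c {m..<k} \<omega> t)}"
  proof (intro subset_antisym subsetI)
    fix \<omega>
    assume "\<omega> \<in> {\<omega> \<in> space M. \<exists>k\<ge>m. \<exists>t\<in>D. 2 * l \<le> norm (wsum c {m..<k} \<omega> t)}"
    then obtain k t n where *: "\<omega> \<in> space M" "m \<le> k" "t \<in> J n" "2 * l \<le> norm (wsum c {m..<k} \<omega> t)"
      by (auto simp: D_eq)
    then have "t \<in> J (max k n)" using J_mono[of n "max k n"] by auto
    with * have "\<omega> \<in> E (max k n)" by (auto simp: E_def intro!: bexI[of _ k])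
    then show "\<omega> \<in> (\<Union>n. E n)" by blast
  next
    fix \<omega>
    assume "\<omega> \<in> (\<Union>n. E n)"
    then obtain n k t where "\<omega> \<in> space M" "m \<le> k" "t \<in> J n" "2 * l \<le> norm (wsum c {m..<k} \<omega> t)"
      by (auto simp: E_def)
    moreover from this have "t \<in> D" by (auto simp: D_eq)
    ultimately show "\<omega> \<in> {\<omega> \<in> space M. \<exists>k\<ge>m. \<exists>t\<in>D. 2 * l \<le> norm (wsum c {m..<k} \<omega> t)}"
      by auto
  qed
  ultimately show ?thesis by simp
qed

section \<open>Almost sure uniform Cauchy property of the noise\<close>

lemma AE_wsum_tail_small:
  assumes D: "countable D" "D \<subseteq> {0..1}" and l: "0 < l" and c: "summable (\<lambda>k. (c k)\<^sup>2)"
  shows "AE \<omega> in M. \<exists>m. \<forall>k\<ge>m. \<forall>t\<in>D. norm (wsum c {m..<k} \<omega> t) < 2 * l"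
proof -
  define E where "E = (\<lambda>m. {\<omega> \<in> space M. \<exists>k\<ge>m. \<exists>t\<in>D. 2 * l \<le> norm (wsum c {m..<k} \<omega> t)})"
  have E_ev: "E m \<in> events" for m
  proof -
    have "E m = (\<Union>k\<in>{m..}. \<Union>t\<in>D. {\<omega> \<in> space M. 2 * l \<le> norm (wsum c {m..<k} \<omega> t)})"
      by (auto simp: E_def)
    also have "\<dots> \<in> events"
      using D by (intro sets.countable_UN'' borel_measurable_le measurable_compose[OF measurable_wsum_M borel_measurable_norm]) auto
    finally show ?thesis .
  qed
  \<comment> \<open>The events \<open>E m\<close> need not be nested, as the starting index moves
    with \<open>m\<close>. For the intersection it is enough to find one good \<open>m\<close> for
    each \<open>e\<close>.\<close>
  have small: "prob (\<Inter>m. E m) \<le> e" if e: "0 < e" for e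
  proof -
    \<comment> \<open>The two entries serve the two demands on the variance: \<open>2 * v\<close> at
      most the square of \<open>l\<close>, and a final bound of at most \<open>e\<close>.\<close>
    define v where "v = min (l\<^sup>2 / 2) (e * l\<^sup>2 / 2)"
    have v: "0 < v" using l e by (simp add: v_def)
    \<comment> \<open>Adding 1 keeps the divisor positive when \<sigma> is zero.\<close>
    define s where "s = \<sigma>\<^sup>2 + 1"
    have s: "0 < s" "\<sigma>\<^sup>2 \<le> s" by (simp_all add: s_def add_nonneg_pos)
    obtain m where m: "\<And>n. norm (\<Sum>k\<in>{m..<n}. (c k)\<^sup>2) < v / s"
      using c v s unfolding summable_Cauchy by (metis divide_pos_pos order_refl)
    have "\<sigma>\<^sup>2 * (\<Sum>k\<in>{m..<n}. (c k)\<^sup>2) \<le> v" for n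
    proof -
      have "\<sigma>\<^sup>2 * (\<Sum>k\<in>{m..<n}. (c k)\<^sup>2) \<le> s * (v / s)"
        using m[of n] s by (intro mult_mono) (auto simp: sum_nonneg)
      then show ?thesis using s by simp
    qed
    moreover have "2 * v \<le> l\<^sup>2" by (simp add: v_def min_def)
    ultimately have "prob (E m) \<le> 2 * v / l\<^sup>2"
      unfolding E_def by (intro maximal_inequality_countable[OF D l])
    also have "\<dots> \<le> e"
      using l by (simp add: v_def min_def field_simps)
    finally have "prob (E m) \<le> e" .
    moreover have "prob (\<Inter>m. E m) \<le> prob (E m)"
      using E_ev by (intro finite_measure_mono) auto
    ultimately show ?thesis by simp
  qed
  have "prob (\<Inter>m. E m) = 0"
    by (rule antisym[OF field_le_epsilon]) (use small in auto)
  then have "(\<Inter>m. E m) \<in> null_sets M"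
    using E_ev by (auto simp: null_sets_def emeasure_eq_measure)
  then have "AE \<omega> in M. \<omega> \<notin> (\<Inter>m. E m)"
    by (rule AE_not_in)
  then show ?thesis
    using AE_space
  proof eventually_elim
    case (elim \<omega>)
    then obtain m where "\<omega> \<notin> E m" by auto
    then show ?case
      using \<open>\<omega> \<in> space M\<close> unfolding E_def mem_Collect_eq by (meson not_le)
  qed
qed

text \<open>Thresholds of the form \<open>2 / (r + 1)\<close> are countably many, so one null set
  serves all \<open>e\<close>. A block between two late indices is the difference of two sums with
  the common start \<open>m0\<close>.\<close>

lemma AE_wsum_uniformly_Cauchy:
  assumes D: "countable D" "D \<subseteq> {0..1}" and c: "summable (\<lambda>k. (c k)\<^sup>2)"
  shows "AE \<omega> in M. \<forall>e>0. \<exists>m0. \<forall>m\<ge>m0. \<forall>n\<ge>m. \<forall>t\<in>D. norm (wsum c {m..<n} \<omega> t) \<le> e"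
proof -
  have "AE \<omega> in M. \<forall>r::nat. \<exists>m. \<forall>k\<ge>m. \<forall>t\<in>D. norm (wsum c {m..<k} \<omega> t) < 2 * (1 / real (Suc r))"
    unfolding AE_all_countable by (intro allI AE_wsum_tail_small[OF D _ c]) simp
  then show ?thesis
  proof eventually_elim
    case (elim \<omega>)
    show ?case
    proof (intro allI impI)
      fix e :: real
      assume "0 < e"
      \<comment> \<open>The quarter: each of the two sums from \<open>m0\<close> is below twice
        \<open>1 / real (Suc r)\<close>.\<close>
      then obtain r where r: "1 / real (Suc r) < e / 4"
        using nat_approx_posE[of "e / 4"] by auto
      from elim obtain m0 where m0: "\<And>k t. m0 \<le> k \<Longrightarrow> t \<in> D \<Longrightarrow>
          norm (wsum c {m0..<k} \<omega> t) < 2 * (1 / real (Suc r))" by blast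
      have "norm (wsum c {m..<n} \<omega> t) \<le> e" if "m0 \<le> m" "m \<le> n" "t \<in> D" for m n t
      proof -
        have "wsum c {m..<n} \<omega> t = wsum c {m0..<n} \<omega> t - wsum c {m0..<m} \<omega> t"
          using wsum_atLeastLessThan_concat[of m0 m n c \<omega> t] that by simp
        also have "norm \<dots> \<le> norm (wsum c {m0..<n} \<omega> t) + norm (wsum c {m0..<m} \<omega> t)"
          by (rule norm_triangle_ineq4)
        also have "\<dots> \<le> e"
          using m0[of n t] m0[of m t] that r by simp
        finally show ?thesis .
      qed
      then show "\<exists>m0. \<forall>m\<ge>m0. \<forall>n\<ge>m. \<forall>t\<in>D. norm (wsum c {m..<n} \<omega> t) \<le> e" by blast
    qed
  qed
qed

end

subsection \<open>Almost sure convergence\<close>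

theorem theorem2:
  fixes B :: "(real \<Rightarrow> real ^ 'd) set"
    and G :: "(real \<Rightarrow> real ^ 'd) \<Rightarrow> (real \<Rightarrow> real ^ 'd)"
    and xstar x0 :: "real \<Rightarrow> real ^ 'd"
    and \<rho> \<theta> \<sigma> :: real
    and \<alpha> :: "nat \<Rightarrow> real"
    and M :: "'w measure"
    and Z X :: "nat \<Rightarrow> 'w \<Rightarrow> real \<Rightarrow> real ^ 'd"
  assumes B: "B = C01 \<or> B = D01"
    and G_maps: "G \<in> B \<rightarrow> B"
    and xstar_in: "xstar \<in> B"
    and xstar_root: "G xstar = (\<lambda>t. 0)"
    and xstar_unique: "\<And>x. x \<in> B \<Longrightarrow> G x = (\<lambda>t. 0) \<Longrightarrow> x = xstar"
    and rho: "0 < \<rho>" "\<rho> < 1"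
    and theta: "1 \<le> \<theta>"
    and contraction: "\<And>x. x \<in> B \<Longrightarrow>
          sup_norm (\<lambda>t. inverse \<theta> *\<^sub>R G x t - (x t - xstar t))
            \<le> \<rho> * sup_norm (\<lambda>t. x t - xstar t)"
    and alpha_range: "\<And>n. 0 < \<alpha> n \<and> \<alpha> n < 1"
    and alpha_lim: "\<alpha> \<longlonglongrightarrow> 0"
    and alpha_sum: "filterlim (\<lambda>n. \<Sum>k<n. \<alpha> k) at_top sequentially"
    and alpha_sq: "summable (\<lambda>n. (\<alpha> n)\<^sup>2)"
    and prob: "prob_space M"
    and Z_mart: "\<And>n. valued_martingale M B (Z n)"
    and Z_indep: "prob_space.indep_sets M (\<lambda>n. sets (process_sigma M (Z n) {0..1})) UNIV"
    and Z_zero: "\<And>n. AE \<omega> in M. Z n \<omega> 0 = 0"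
    and Z_var: "\<And>n. (\<integral>\<^sup>+\<omega>. ennreal ((norm (Z n \<omega> 1))\<^sup>2) \<partial>M) \<le> ennreal (\<sigma>\<^sup>2)"
    and x0: "x0 \<in> B"
    and X_0: "\<And>\<omega>. \<omega> \<in> space M \<Longrightarrow> X 0 \<omega> = x0"
    and X_Suc: "\<And>n \<omega>. \<omega> \<in> space M \<Longrightarrow>
          X (Suc n) \<omega> = (\<lambda>t. X n \<omega> t - \<alpha> n *\<^sub>R (G (X n \<omega>) t + Z (Suc n) \<omega> t))"
  shows "AE \<omega> in M. (\<lambda>n. sup_norm (\<lambda>t. X n \<omega> t - xstar t)) \<longlonglongrightarrow> 0"
proof -
  interpret prob_space M by (rule prob)
  interpret independent_martingales M Z \<sigma>
  proof
    show "martingale01 M (Z n)" for n using Z_mart by (simp add: valued_martingale_def)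
  qed (fact Z_indep Z_zero Z_var)+
  \<comment> \<open>Step \<open>k\<close> of the iteration uses \<open>Z (Suc k)\<close>, while
    \<open>wsum\<close> pairs \<open>c k\<close> with \<open>Z k\<close>. Truncated subtraction
    makes \<open>c 0\<close> equal to \<open>\<alpha> 0\<close>, but the sums used below start at
    \<open>Suc m\<close> and never meet it.\<close>
  define c where "c = (\<lambda>k. \<alpha> (k - 1))"
  have "summable (\<lambda>k. (c (Suc k))\<^sup>2)"
    using alpha_sq by (simp add: c_def)
  then have c: "summable (\<lambda>k. (c k)\<^sup>2)"
    by (subst (asm) summable_Suc_iff)
  have wsum_Suc: "wsum c {Suc m..<Suc n} \<omega> t = (\<Sum>k\<in>{m..<n}. \<alpha> k *\<^sub>R Z (Suc k) \<omega> t)" for m n \<omega> t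
    unfolding wsum_def sum.shift_bounds_Suc_ivl by (simp add: c_def)
  have "countable ({0..1} \<inter> \<rat> :: real set)"
    by (intro countable_Int2 countable_rat)
  from AE_wsum_uniformly_Cauchy[OF this _ c]
  have "AE \<omega> in M. \<forall>e>0. \<exists>m0. \<forall>m\<ge>m0. \<forall>n\<ge>m. \<forall>t\<in>{0..1} \<inter> \<rat>. norm (wsum c {m..<n} \<omega> t) \<le> e"
    by auto
  then show ?thesis
    using AE_space
  proof eventually_elim
    \<comment> \<open>From here on the outcome is fixed and the argument is deterministic: the null
      set was spent on the noise, and \<open>X\<close> is examined one path at a time.\<close>
    case (elim \<omega>)
    have Z_in: "Z n \<omega> \<in> B" for n
      using Z_mart[of n] elim(2) by (auto simp: valued_martingale_def)
    then have Z_D: "Z n \<omega> \<in> D01" for n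
      using B C01_subset_D01 by auto
    show ?case
    proof (rule perturbed_contraction_converges[where x = "\<lambda>n. X n \<omega>" and z = "\<lambda>n. Z (Suc n) \<omega>"
            and \<alpha> = \<alpha>, OF B G_maps xstar_in _ Z_in rho _ contraction _ alpha_lim alpha_sum])
      show "X 0 \<omega> \<in> B" using X_0 x0 elim(2) by simp
      show "0 < \<theta>" using theta by simp
      show "0 \<le> \<alpha> n" for n using alpha_range[of n] by simp
      show "X (Suc n) \<omega> = (\<lambda>t. X n \<omega> t - \<alpha> n *\<^sub>R (G (X n \<omega>) t + Z (Suc n) \<omega> t))" for n
        by (rule X_Suc[OF elim(2)])
      fix e :: real
      assume "0 < e"
      with elim(1) obtain m0 where m0: "\<And>m n t. m0 \<le> m \<Longrightarrow> m \<le> n \<Longrightarrow> t \<in> {0..1} \<inter> \<rat> \<Longrightarrow>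
          norm (wsum c {m..<n} \<omega> t) \<le> e" by blast
      have "norm (\<Sum>k\<in>{m..<n}. \<alpha> k *\<^sub>R Z (Suc k) \<omega> t) \<le> e" if "m0 \<le> m" "m \<le> n" "t \<in> {0..1}" for m n t
      proof (rule D01_norm_le_if_rational[OF _ _ that(3)])
        show "(\<lambda>t. \<Sum>k\<in>{m..<n}. \<alpha> k *\<^sub>R Z (Suc k) \<omega> t) \<in> D01"
          by (intro D01_weighted_sum Z_D) simp
        show "norm (\<Sum>k\<in>{m..<n}. \<alpha> k *\<^sub>R Z (Suc k) \<omega> s) \<le> e" if "s \<in> {0..1} \<inter> \<rat>" for s
          unfolding wsum_Suc[symmetric] using m0[of "Suc m" "Suc n" s] that \<open>m0 \<le> m\<close> \<open>m \<le> n\<close> by simp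
      qed
      then show "\<exists>m0. \<forall>m\<ge>m0. \<forall>n\<ge>m. \<forall>t\<in>{0..1}. norm (\<Sum>k\<in>{m..<n}. \<alpha> k *\<^sub>R Z (Suc k) \<omega> t) \<le> e"
        by blast
    qed
  qed
qed

end
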